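(* Let $\mathcal{Q} = \{q_y\}_{y \in Y_{\mathcal{Q}}}$, $Y_{\mathcal{Q}} \subseteq \{0,1\}^m$, be a set of counting queries over the data universe $\mathcal{X} = \{0,1\}^d$, and let $\mathcal{F}_{\mathcal{Q}}$ be its $\mathcal{Q}$-function family. Assume that $\mathcal{P}_{t,T}$ efficiently and uniformly $\gamma$-approximates $\mathcal{F}_{\mathcal{Q}}$ on $Y_{\mathcal{Q}}$. Let $N = \binom{m+t}{t}$. Then for every $\varepsilon > 0$ there is a sanitizer $\mathcal{A}: (\{0,1\}^d)^n \to \mathbb{R}^{N}$ (with an evaluator) that (1) is $\varepsilon$-differentially private, (2) runs in time $\mathrm{poly}(n, d, N, \log T, \log(1/\varepsilon))$, and (3) is $(\alpha,\beta)$-accurate for $\mathcal{Q}$ for every $\beta>0$, where $\alpha = \gamma + \frac{4TN^2\log(N/\beta)}{\varepsilon n}$.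
   Context: A database $D \in \mathcal{X}^n$ is a list of rows $x^{(1)},\dots,x^{(n)}$; adjacent databases differ in exactly one row. A counting query is a predicate $q:\mathcal{X}\to\{0,1\}$ with $q(D)=\frac1n\sum_i q(x^{(i)})$. A sanitizer $\mathcal{A}$ is a randomized map from databases to a set $\mathcal{R}$, with answers computed by an evaluator $\mathcal{E}:\mathcal{R}\times\mathcal{Q}\to\mathbb{R}$ (whose running time is included in the sanitizer's running time); write $q(\mathcal{A}(D))=\mathcal{E}(\mathcal{A}(D),q)$. $\mathcal{A}$ is $\varepsilon$-differentially private if for all adjacent $D,D'$ and measurable $S$, $\Pr[\mathcal{A}(D)\in S]\le e^\varepsilon \Pr[\mathcal{A}(D')\in S]$. $\mathcal{A}$ is $(\alpha,\beta)$-accurate for $\mathcal{Q}$ if for every database $D$, $\Pr[\forall q\in\mathcal{Q}: |q(\mathcal{A}(D))-q(D)|\le\alpha]\ge 1-\beta$. Given $\mathcal{Q}=\{q_y\}_{y\in Y_{\mathcal{Q}}}$, the $\mathcal{Q}$-function family is $\mathcal{F}_{\mathcal{Q}} = \{f_x\}_{x \in \mathcal{X}}$ with $f_x:\{0,1\}^m \to\{0,1\}$, $f_x(y) = q_y(x)$. $\mathcal{P}_{t,T}$ is the set of $m$-variate real polynomials of total degree at most $t$ all of whose coefficients have absolute value at most $T$; such a polynomial is identified with its coefficient vector in $[-T,T]^{\binom{m+t}{t}}$. $\mathcal{P}_{t,T}$ uniformly $\gamma$-approximates a family $\{f_x\}_{x\in\mathcal{X}}$ on $Y$ if for every $x$ there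 is $p_x\in\mathcal{P}_{t,T}$ with $\max_{y\in Y}|f_x(y)-p_x(y)|\le\gamma$; it does so efficiently if there is an algorithm that on input $x\in\mathcal{X}$ runs in time $\mathrm{poly}(\log|\mathcal{X}|,\binom{m+t}{t},\log T)$ and outputs the coefficient vector of such a $p_x$. *)

theory Defs
  imports "HOL-Probability.Probability"
begin

section \<open>Model of computation\<close>

text \<open>
  Running times are measured for programs of a small first-order, call-by-value language
  over exact real numbers and cons cells (an idealised pointer machine / real RAM).  A unit-cost
  step is an arithmetic operation, a logarithm, a comparison of reals, a list operation,
  a variable access, a call, or a draw of a uniform real number from the unit interval.  There is
  no rounding operation, and the only constants are integers.
\<close>

datatype val = VReal real | VNil | VCons val val

datatype aop = Add | Sub | Mul | Div

datatype tm =
    TVar nat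
  | TNum int
  | TNil
  | TCons tm tm
  | THead tm
  | TTail tm
  | TOp aop tm tm
  | TLn tm
  | TIfLe tm tm tm tm
  | TIfNil tm tm tm
  | TLet tm tm
  | TCall tm tm
  | TSelf tm
  | TUnif

text \<open>Division by zero and logarithms of non-positive numbers follow the HOL conventions.\<close>

fun apply_aop :: "aop \<Rightarrow> real \<Rightarrow> real \<Rightarrow> real" where
  "apply_aop Add r s = r + s"
| "apply_aop Sub r s = r - s"
| "apply_aop Mul r s = r * s"
| "apply_aop Div r s = r / s"

text \<open>
  In \<open>eval \<omega> F \<rho> e i v j c\<close> the expression \<open>e\<close> is evaluated in the environment \<open>\<rho>\<close>
  (de Bruijn indices, most recent binding first) with value \<open>v\<close> and cost \<open>c\<close>; \<open>F\<close> is the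
  body of the function being executed.  \<open>TCall B a\<close> runs the body \<open>B\<close> in an environment
  consisting of the value of \<open>a\<close> alone, and \<open>TSelf a\<close> calls the current function recursively.
  Randomness comes from the tape \<open>\<omega>\<close>, which is read from position \<open>i\<close> up to
  (excluding) position \<open>j\<close>.
\<close>

inductive eval ::
  "(nat \<Rightarrow> real) \<Rightarrow> tm \<Rightarrow> val list \<Rightarrow> tm \<Rightarrow> nat \<Rightarrow> val \<Rightarrow> nat \<Rightarrow> nat \<Rightarrow> bool"
  for \<omega> :: "nat \<Rightarrow> real"
where
  eval_Var: "n < length \<rho> \<Longrightarrow> eval \<omega> F \<rho> (TVar n) i (\<rho> ! n) i 1"
| eval_Num: "eval \<omega> F \<rho> (TNum z) i (VReal (of_int z)) i 1"
| eval_Nil: "eval \<omega> F \<rho> TNil i VNil i 1"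
| eval_Cons: "\<lbrakk>eval \<omega> F \<rho> a i v j c1; eval \<omega> F \<rho> b j w k c2\<rbrakk>
    \<Longrightarrow> eval \<omega> F \<rho> (TCons a b) i (VCons v w) k (c1 + c2 + 1)"
| eval_Head: "eval \<omega> F \<rho> a i (VCons v w) j c1
    \<Longrightarrow> eval \<omega> F \<rho> (THead a) i v j (c1 + 1)"
| eval_Tail: "eval \<omega> F \<rho> a i (VCons v w) j c1
    \<Longrightarrow> eval \<omega> F \<rho> (TTail a) i w j (c1 + 1)"
| eval_Op: "\<lbrakk>eval \<omega> F \<rho> a i (VReal r) j c1; eval \<omega> F \<rho> b j (VReal s) k c2\<rbrakk>
    \<Longrightarrow> eval \<omega> F \<rho> (TOp f a b) i (VReal (apply_aop f r s)) k (c1 + c2 + 1)"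
| eval_Ln: "eval \<omega> F \<rho> a i (VReal r) j c1
    \<Longrightarrow> eval \<omega> F \<rho> (TLn a) i (VReal (ln r)) j (c1 + 1)"
| eval_IfLe: "\<lbrakk>eval \<omega> F \<rho> a i (VReal r) j c1; eval \<omega> F \<rho> b j (VReal s) k c2;
      eval \<omega> F \<rho> (if r \<le> s then e1 else e2) k v l c3\<rbrakk>
    \<Longrightarrow> eval \<omega> F \<rho> (TIfLe a b e1 e2) i v l (c1 + c2 + c3 + 1)"
| eval_IfNil_Nil: "\<lbrakk>eval \<omega> F \<rho> a i VNil j c1; eval \<omega> F \<rho> e1 j v k c2\<rbrakk>
    \<Longrightarrow> eval \<omega> F \<rho> (TIfNil a e1 e2) i v k (c1 + c2 + 1)"
| eval_IfNil_Cons: "\<lbrakk>eval \<omega> F \<rho> a i (VCons u w) j c1; eval \<omega> F \<rho> e2 j v k c2\<rbrakk>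
    \<Longrightarrow> eval \<omega> F \<rho> (TIfNil a e1 e2) i v k (c1 + c2 + 1)"
| eval_Let: "\<lbrakk>eval \<omega> F \<rho> a i u j c1; eval \<omega> F (u # \<rho>) b j v k c2\<rbrakk>
    \<Longrightarrow> eval \<omega> F \<rho> (TLet a b) i v k (c1 + c2 + 1)"
| eval_Call: "\<lbrakk>eval \<omega> F \<rho> a i u j c1; eval \<omega> B [u] B j v k c2\<rbrakk>
    \<Longrightarrow> eval \<omega> F \<rho> (TCall B a) i v k (c1 + c2 + 1)"
| eval_Self: "\<lbrakk>eval \<omega> F \<rho> a i u j c1; eval \<omega> F [u] F j v k c2\<rbrakk>
    \<Longrightarrow> eval \<omega> F \<rho> (TSelf a) i v k (c1 + c2 + 1)"
| eval_Unif: "eval \<omega> F \<rho> TUnif i (VReal (\<omega> i)) (Suc i) 1"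

inductive_cases eval_elims:
  "eval \<omega> F \<rho> (TVar n) i v j c"
  "eval \<omega> F \<rho> (TNum z) i v j c"
  "eval \<omega> F \<rho> TNil i v j c"
  "eval \<omega> F \<rho> (TCons a b) i v j c"
  "eval \<omega> F \<rho> (THead a) i v j c"
  "eval \<omega> F \<rho> (TTail a) i v j c"
  "eval \<omega> F \<rho> (TOp f a b) i v j c"
  "eval \<omega> F \<rho> (TLn a) i v j c"
  "eval \<omega> F \<rho> (TIfLe a b e1 e2) i v j c"
  "eval \<omega> F \<rho> (TIfNil a e1 e2) i v j c"
  "eval \<omega> F \<rho> (TLet a b) i v j c"
  "eval \<omega> F \<rho> (TCall B a) i v j c"
  "eval \<omega> F \<rho> (TSelf a) i v j c"
  "eval \<omega> F \<rho> TUnif i v j c"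

lemma eval_functional:
  "eval \<omega> F \<rho> e i v j c \<Longrightarrow> eval \<omega> F \<rho> e i v' j' c' \<Longrightarrow> v' = v \<and> j' = j \<and> c' = c"
proof (induction arbitrary: v' j' c' rule: eval.induct)
  case eval_Var
  from eval_Var.prems show ?case by (auto elim!: eval_elims)
next
  case eval_Num
  from eval_Num.prems show ?case by (auto elim!: eval_elims)
next
  case eval_Nil
  from eval_Nil.prems show ?case by (auto elim!: eval_elims)
next
  case eval_Cons
  from eval_Cons.prems show ?case by (auto elim!: eval_elims dest!: eval_Cons.IH)
next
  case eval_Head
  from eval_Head.prems show ?case by (auto elim!: eval_elims dest!: eval_Head.IH)
next
  case eval_Tail
  from eval_Tail.prems show ?case by (auto elim!: eval_elims dest!: eval_Tail.IH)
next
  case eval_Op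
  from eval_Op.prems show ?case by (auto elim!: eval_elims dest!: eval_Op.IH)
next
  case eval_Ln
  from eval_Ln.prems show ?case by (auto elim!: eval_elims dest!: eval_Ln.IH)
next
  case eval_IfLe
  from eval_IfLe.prems show ?case by (auto elim!: eval_elims dest!: eval_IfLe.IH)
next
  case eval_IfNil_Nil
  from eval_IfNil_Nil.prems show ?case by (auto elim!: eval_elims dest!: eval_IfNil_Nil.IH)
next
  case eval_IfNil_Cons
  from eval_IfNil_Cons.prems show ?case by (auto elim!: eval_elims dest!: eval_IfNil_Cons.IH)
next
  case eval_Let
  from eval_Let.prems show ?case by (auto elim!: eval_elims dest!: eval_Let.IH)
next
  case eval_Call
  from eval_Call.prems show ?case by (auto elim!: eval_elims dest!: eval_Call.IH)
next
  case eval_Self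
  from eval_Self.prems show ?case by (auto elim!: eval_elims dest!: eval_Self.IH)
next
  case eval_Unif
  from eval_Unif.prems show ?case by (auto elim!: eval_elims)
qed

text \<open>
  A run of program \<open>P\<close> on the input value \<open>u\<close> starts at the beginning of the tape.
  Deterministic computations read nothing from the tape.
\<close>

definition runs :: "(nat \<Rightarrow> real) \<Rightarrow> tm \<Rightarrow> val \<Rightarrow> val \<Rightarrow> nat \<Rightarrow> bool" where
  "runs \<omega> P u v c \<longleftrightarrow> (\<exists>j. eval \<omega> P [u] P 0 v j c)"

definition runs_det :: "tm \<Rightarrow> val \<Rightarrow> val \<Rightarrow> nat \<Rightarrow> bool" where
  "runs_det P u v c \<longleftrightarrow> (\<forall>\<omega>. eval \<omega> P [u] P 0 v 0 c)"

definition tape :: "(nat \<Rightarrow> real) measure" where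
  "tape = (\<Pi>\<^sub>M i\<in>UNIV. restrict_space lborel {0..1})"

text \<open>
  A quantity is \<open>poly(a, b, \<dots>)\<close>, for nonnegative \<open>a, b, \<dots>\<close>, iff it is at most
  \<open>poly_bound C K [a, b, \<dots>]\<close> for some constants \<open>C\<close> and \<open>K\<close>.  Logarithms occurring as
  arguments are truncated at 0.
\<close>

definition poly_bound :: "nat \<Rightarrow> nat \<Rightarrow> real list \<Rightarrow> real" where
  "poly_bound C K as = real C * (1 + sum_list as) ^ K"

definition lnp :: "real \<Rightarrow> real" where
  "lnp x = ln (max 1 x)"

section \<open>Databases and counting queries\<close>

type_synonym bits = "bool list"

definition cube :: "nat \<Rightarrow> bits set" where
  "cube d = {x. length x = d}"

definition databases :: "nat \<Rightarrow> nat \<Rightarrow> bits list set" where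
  "databases d n = {D. length D = n \<and> set D \<subseteq> cube d}"

definition adjacent :: "bits list \<Rightarrow> bits list \<Rightarrow> bool" where
  "adjacent D D' \<longleftrightarrow> length D = length D' \<and> card {i. i < length D \<and> D ! i \<noteq> D' ! i} = 1"

text \<open>
  A family of predicates \<open>q\<^sub>y : {0,1}\<^sup>d \<rightarrow> {0,1}\<close> is a function \<open>q\<close> with
  \<open>q y x = q\<^sub>y(x)\<close>.
\<close>

definition query_value :: "(bits \<Rightarrow> bool) \<Rightarrow> bits list \<Rightarrow> real" where
  "query_value p D = (\<Sum>i<length D. of_bool (p (D ! i))) / real (length D)"

definition query_fun :: "(bits \<Rightarrow> bits \<Rightarrow> bool) \<Rightarrow> bits \<Rightarrow> bits \<Rightarrow> real" where
  "query_fun q x y = of_bool (q y x)"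

section \<open>Polynomials as coefficient vectors\<close>

text \<open>Vectors in $\mathbb{R}^N$ are extensional functions on the index set \<open>{..<N}\<close>.\<close>

definition RN :: "nat \<Rightarrow> (nat \<Rightarrow> real) measure" where
  "RN N = (\<Pi>\<^sub>M i\<in>{..<N}. borel)"

text \<open>
  The exponent vectors of the monomials in \<open>m\<close> variables of total degree at most \<open>t\<close>, in
  lexicographic order; they fix the identification of polynomials with coefficient vectors.
\<close>

fun exponents :: "nat \<Rightarrow> nat \<Rightarrow> nat list list" where
  "exponents 0 t = [[]]"
| "exponents (Suc m) 0 = [replicate (Suc m) 0]"
| "exponents (Suc m) (Suc t) =
     map ((#) 0) (exponents m (Suc t)) @ map (\<lambda>e. Suc (hd e) # tl e) (exponents (Suc m) t)"

lemma length_exponents: "length (exponents m t) = (m + t) choose t"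
  by (induction m t rule: exponents.induct) (auto simp: add.commute)

lemma set_exponents: "set (exponents m t) = {e. length e = m \<and> sum_list e \<le> t}"
proof (induction m t rule: exponents.induct)
  case (1 t)
  then show ?case by auto
next
  case (2 m)
  have "e = replicate (Suc m) 0" if "length e = Suc m" "sum_list e = 0" for e :: "nat list"
    using that by (intro replicate_eqI) auto
  then show ?case by (auto simp: sum_list_replicate)
next
  case (3 m t)
  have "e \<in> set (exponents (Suc m) (Suc t)) \<longleftrightarrow> length e = Suc m \<and> sum_list e \<le> Suc t" for e
  proof (cases e)
    case Nil
    then show ?thesis by auto
  next
    case (Cons a f)
    show ?thesis
    proof (cases a)
      case 0
      then show ?thesis using Cons 3 by auto
    next
      case (Suc b)
      have "e \<in> set (exponents (Suc m) (Suc t)) \<longleftrightarrow> b # f \<in> set (exponents (Suc m) t)"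
      proof
        assume "e \<in> set (exponents (Suc m) (Suc t))"
        then obtain g where g: "g \<in> set (exponents (Suc m) t)" "e = Suc (hd g) # tl g"
          using Cons Suc by auto
        then have "length g = Suc m" using 3 by auto
        then have "g = b # f" using g Cons Suc by (cases g) auto
        then show "b # f \<in> set (exponents (Suc m) t)" using g by simp
      next
        assume "b # f \<in> set (exponents (Suc m) t)"
        then have "Suc (hd (b # f)) # tl (b # f) \<in> set (exponents (Suc m) (Suc t))"
          unfolding exponents.simps set_append set_map by blast
        then show "e \<in> set (exponents (Suc m) (Suc t))" using Cons Suc by simp
      qed
      then show ?thesis using Cons Suc 3 by simp
    qed
  qed
  then show ?case by blast
qed

definition poly_eval :: "nat \<Rightarrow> nat \<Rightarrow> (nat \<Rightarrow> real) \<Rightarrow> bits \<Rightarrow> real" where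
  "poly_eval m t p y =
     (\<Sum>i<length (exponents m t). p i * (\<Prod>j<m. of_bool (y ! j) ^ (exponents m t ! i ! j)))"

definition polys :: "nat \<Rightarrow> nat \<Rightarrow> real \<Rightarrow> (nat \<Rightarrow> real) set" where
  "polys m t T = {..<(m + t) choose t} \<rightarrow>\<^sub>E {-T..T}"

definition approximates ::
  "nat \<Rightarrow> nat \<Rightarrow> real \<Rightarrow> bits set \<Rightarrow> (bits \<Rightarrow> real) \<Rightarrow> (nat \<Rightarrow> real) \<Rightarrow> bool" where
  "approximates m t \<gamma> Y f p \<longleftrightarrow> (\<forall>y\<in>Y. \<bar>f y - poly_eval m t p y\<bar> \<le> \<gamma>)"

definition uniformly_approximates ::
  "nat \<Rightarrow> nat \<Rightarrow> nat \<Rightarrow> real \<Rightarrow> real \<Rightarrow> bits set \<Rightarrow> (bits \<Rightarrow> bits \<Rightarrow> bool) \<Rightarrow> bool" where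
  "uniformly_approximates d m t T \<gamma> Y q \<longleftrightarrow>
     (\<forall>x\<in>cube d. \<exists>p\<in>polys m t T. approximates m t \<gamma> Y (query_fun q x) p)"

section \<open>Encodings of inputs and outputs\<close>

fun vlist :: "val list \<Rightarrow> val" where
  "vlist [] = VNil"
| "vlist (v # vs) = VCons v (vlist vs)"

definition vbits :: "bits \<Rightarrow> val" where
  "vbits x = vlist (map (\<lambda>b. VReal (of_bool b)) x)"

definition vdb :: "bits list \<Rightarrow> val" where
  "vdb D = vlist (map vbits D)"

definition vvec :: "nat \<Rightarrow> (nat \<Rightarrow> real) \<Rightarrow> val" where
  "vvec N r = vlist (map (\<lambda>i. VReal (r i)) [0..<N])"

text \<open>
  Polynomial running times only make sense for algorithms that work for a whole family of query
  sets.  All algorithms are therefore uniform: they are told which instance they have to deal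
  with, by its numerical parameters and a further tuple \<open>\<iota>\<close> of natural numbers identifying the
  query set within its family (for instance the arity of the marginals considered).
\<close>

definition vinst :: "nat list \<Rightarrow> nat \<Rightarrow> nat \<Rightarrow> nat \<Rightarrow> real \<Rightarrow> val" where
  "vinst \<iota> d m t T = vlist
     [vlist (map (\<lambda>k. VReal (real k)) \<iota>),
      VReal (real d), VReal (real m), VReal (real t), VReal T]"

text \<open>
  \<open>P\<close> is the approximation algorithm, and \<open>C\<close> and \<open>K\<close> describe its polynomial time
  bound; \<open>d\<close> is the logarithm of the size of the data universe.
\<close>

definition efficiently_uniformly_approximates ::
  "tm \<Rightarrow> nat \<Rightarrow> nat \<Rightarrow> nat list \<Rightarrow> nat \<Rightarrow> nat \<Rightarrow> nat \<Rightarrow> real \<Rightarrow> real \<Rightarrow> bits set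
     \<Rightarrow> (bits \<Rightarrow> bits \<Rightarrow> bool) \<Rightarrow> bool" where
  "efficiently_uniformly_approximates P C K \<iota> d m t T \<gamma> Y q \<longleftrightarrow>
     uniformly_approximates d m t T \<gamma> Y q \<and>
     (\<forall>x\<in>cube d. \<exists>p\<in>polys m t T. approximates m t \<gamma> Y (query_fun q x) p \<and>
        (\<exists>c. runs_det P (VCons (vinst \<iota> d m t T) (vbits x)) (vvec ((m + t) choose t) p) c \<and>
             real c \<le> poly_bound C K [real d, real ((m + t) choose t), lnp T]))"

section \<open>Sanitizers\<close>

text \<open>
  A sanitizer is given by the output distribution \<open>A D\<close> on $\mathbb{R}^N$ for every database
  \<open>D\<close>, and an evaluator \<open>E\<close>; queries are represented by their indices \<open>y \<in> Y\<close>.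
\<close>

definition differentially_private ::
  "real \<Rightarrow> nat \<Rightarrow> nat \<Rightarrow> nat \<Rightarrow> (bits list \<Rightarrow> (nat \<Rightarrow> real) measure) \<Rightarrow> bool" where
  "differentially_private \<epsilon> N d n A \<longleftrightarrow>
     (\<forall>D\<in>databases d n. \<forall>D'\<in>databases d n. adjacent D D' \<longrightarrow>
        (\<forall>S\<in>sets (RN N). measure (A D) S \<le> exp \<epsilon> * measure (A D') S))"

definition accurate ::
  "real \<Rightarrow> real \<Rightarrow> nat \<Rightarrow> nat \<Rightarrow> nat \<Rightarrow> bits set \<Rightarrow> (bits \<Rightarrow> bits \<Rightarrow> bool)
     \<Rightarrow> (bits list \<Rightarrow> (nat \<Rightarrow> real) measure) \<Rightarrow> ((nat \<Rightarrow> real) \<Rightarrow> bits \<Rightarrow> real) \<Rightarrow> bool" where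
  "accurate \<alpha> \<beta> N d n Y q A E \<longleftrightarrow>
     (\<forall>D\<in>databases d n.
        {r \<in> space (RN N). \<forall>y\<in>Y. \<bar>E r y - query_value (q y) D\<bar> \<le> \<alpha>} \<in> sets (RN N) \<and>
        measure (A D) {r \<in> space (RN N). \<forall>y\<in>Y. \<bar>E r y - query_value (q y) D\<bar> \<le> \<alpha>}
          \<ge> 1 - \<beta>)"

text \<open>
  The program \<open>P\<close> samples from \<open>A D\<close> on input \<open>D\<close>, within \<open>B\<close> steps for every outcome of
  the random draws.
\<close>

definition sanitizer_in_time ::
  "tm \<Rightarrow> val \<Rightarrow> real \<Rightarrow> nat \<Rightarrow> nat \<Rightarrow> nat \<Rightarrow> (bits list \<Rightarrow> (nat \<Rightarrow> real) measure)
     \<Rightarrow> real \<Rightarrow> bool" where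
  "sanitizer_in_time P inst \<epsilon> N d n A B \<longleftrightarrow>
     (\<forall>D\<in>databases d n. \<exists>out \<in> measurable tape (RN N).
        A D = distr tape (RN N) out \<and>
        (\<forall>\<omega>\<in>space tape. \<exists>c.
           runs \<omega> P (VCons inst (VCons (VReal \<epsilon>) (vdb D))) (vvec N (out \<omega>)) c \<and>
           real c \<le> B))"

definition evaluator_in_time ::
  "tm \<Rightarrow> val \<Rightarrow> real \<Rightarrow> nat \<Rightarrow> bits set \<Rightarrow> ((nat \<Rightarrow> real) \<Rightarrow> bits \<Rightarrow> real) \<Rightarrow> real \<Rightarrow> bool" where
  "evaluator_in_time P inst \<epsilon> N Y E B \<longleftrightarrow>
     (\<forall>r\<in>space (RN N). \<forall>y\<in>Y. \<exists>c.
        runs_det P (VCons inst (VCons (VReal \<epsilon>) (VCons (vvec N r) (vbits y))))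
          (VReal (E r y)) c \<and>
        real c \<le> B)"

end

(* The sanitizer averages the coefficient vectors p_x over the rows x of the database and adds
   independent Laplace noise of scale b = 2TN/(eps n) to each of the N coordinates.  Changing one
   row moves every coordinate by at most 2T/n, so the L1 sensitivity is 2TN/n, and shifting the
   density exp(-|x|)/2 of the noise costs a factor exp(eps).  Monomials are bounded by 1 on the
   cube, so a query is off by at most gamma + N b s once all N noise variables are at most s in
   absolute value; a union bound with s = ln(N/beta) gives the accuracy.

   All rows are processed before the first random draw, because the approximation algorithm is
   only known to run correctly at the beginning of the tape.  The evaluator follows the recursion
   of exponents, whose recursion tree has N leaves, so that its running time depends on m and t
   only through N. *)
theory Submission
  imports Defs
begin

section \<open>Laplace noise\<close>



text \<open>
  Inverse transform sampling.  At the end points \<open>u = 0\<close> and \<open>u = 1\<close>, where the quantile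
  function is infinite, \<open>ln 0 = 0\<close> makes the value 0.
\<close>

definition lap :: "real \<Rightarrow> real" where
  "lap u = (if 2 * u \<le> 1 then ln (2 * u) else - ln (2 - 2 * u))"

definition unif :: "real measure" where
  "unif = restrict_space lborel {0..1}"

definition laplace :: "real measure" where
  "laplace = density lborel (\<lambda>x. ennreal (exp (- \<bar>x\<bar>) / 2))"

lemma prob_space_unif: "prob_space unif"
  by (auto intro!: prob_spaceI simp: unif_def emeasure_restrict_space space_restrict_space)

lemma space_unif: "space unif = {0..1}"
  by (simp add: unif_def space_restrict_space)

lemma lap_measurable [measurable]: "lap \<in> borel_measurable borel"
  unfolding lap_def by measurable

lemma unif_measurable: "f \<in> borel_measurable borel \<Longrightarrow> f \<in> borel_measurable unif"
  unfolding unif_def by (intro measurable_restrict_space1) simp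

lemma lap_measurable_unif [measurable]: "lap \<in> borel_measurable unif"
  by (rule unif_measurable) measurable

text \<open>The distribution function of \<open>laplace\<close>. Its two branches share the value
  1/2 and the slope 1/2 at 0, so they glue to an antiderivative that is differentiable at every
  point.\<close>

lemma laplace_cdf_deriv:
  "((\<lambda>x::real. if x \<le> 0 then exp x / 2 else 1 - exp (- x) / 2)
     has_real_derivative exp (- \<bar>x\<bar>) / 2) (at x)"
proof -
  have "((\<lambda>x::real. if x \<in> {..0} then exp x / 2 else 1 - exp (- x) / 2)
     has_vector_derivative (if x \<in> {..0} then exp x / 2 else exp (- x) / 2)) (at x within UNIV)"
    by (rule has_vector_derivative_If_within_closures[where T = "{0..}"])
       (auto intro!: derivative_eq_intros simp flip: has_real_derivative_iff_has_vector_derivative)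
  moreover have "(if x \<in> {..0} then exp x / 2 else exp (- x) / 2) = exp (- \<bar>x\<bar>) / 2"
    by simp
  ultimately show ?thesis
    by (simp only: has_real_derivative_iff_has_vector_derivative atMost_iff)
qed

lemma emeasure_laplace_greaterThan:
  "emeasure laplace {z<..} = ennreal (if z \<le> 0 then 1 - exp z / 2 else exp (- z) / 2)"
proof -
  let ?F = "\<lambda>x::real. if x \<le> 0 then exp x / 2 else 1 - exp (- x) / 2"
  have "emeasure laplace {z<..} = (\<integral>\<^sup>+x. ennreal (exp (- \<bar>x\<bar>) / 2) * indicator {z<..} x \<partial>lborel)"
    by (simp add: laplace_def emeasure_density)
  \<comment> \<open>The end point is a null set; the closed half-line is the domain to which the
    fundamental theorem applies.\<close>
  also have "\<dots> = (\<integral>\<^sup>+x. ennreal (exp (- \<bar>x\<bar>) / 2) * indicator {z..} x \<partial>lborel)"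
    by (intro nn_integral_cong_AE) (use AE_lborel_singleton[of z] in \<open>auto elim!: eventually_mono simp: indicator_def\<close>)
  also have "\<dots> = ennreal (1 - ?F z)"
  proof (rule nn_integral_FTC_atLeast)
    have "((\<lambda>x::real. 1 - exp (- x) / 2) \<longlongrightarrow> 1) at_top"
      using tendsto_diff[OF tendsto_const tendsto_divide[OF
        filterlim_compose[OF exp_at_bot filterlim_uminus_at_bot_at_top] tendsto_const], of 2 1] by simp
    moreover have "eventually (\<lambda>x. 1 - exp (- x) / 2 = ?F x) at_top"
      by (rule eventually_mono[OF eventually_gt_at_top[of 0]]) auto
    ultimately show "(?F \<longlongrightarrow> 1) at_top"
      by (rule Lim_transform_eventually)
  qed (use laplace_cdf_deriv in auto)
  finally show ?thesis by (simp add: if_distrib cong: if_cong)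
qed

text \<open>The regimes of \<open>lap\<close>: its two branches, with the end points split off
  because \<open>ln 0 = 0\<close> takes over there.\<close>

lemma unit_interval_cases:
  fixes u :: real
  assumes "u \<in> {0..1}"
  obtains "u = 0" | "0 < u" "2 * u \<le> 1" | "2 * u > 1" "u < 1" | "u = 1"
proof -
  have "u = 0 \<or> (0 < u \<and> 2 * u \<le> 1) \<or> (2 * u > 1 \<and> u < 1) \<or> u = 1"
    using assms by (simp, linarith)
  then show ?thesis using that by blast
qed

text \<open>Measures on the line that agree on all rays \<open>{z<..}\<close>, with finite values,
  are equal. The set where \<open>lap\<close> exceeds \<open>z\<close> is an interval up to an end
  point, so only its length has to be compared with the Laplace tail.\<close>

lemma distr_lap: "distr unif borel lap = laplace"
proof (rule measure_eqI_lessThan)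
  fix z :: real
  have sets: "A \<in> sets lborel \<Longrightarrow> A \<subseteq> {0..1} \<Longrightarrow> emeasure unif A = emeasure lborel A" for A
    by (simp add: unif_def emeasure_restrict_space)
  have "emeasure (distr unif borel lap) {z<..} = emeasure unif {u \<in> {0..1}. z < lap u}"
    by (subst emeasure_distr) (auto intro!: arg_cong[where f = "emeasure unif"] simp: space_unif)
  also have "\<dots> = ennreal (if z \<le> 0 then 1 - exp z / 2 else exp (- z) / 2)"
  proof (cases "z < 0")
    case True
    have "exp z < 1" using True by simp
    then have "exp z < 2" by linarith
    \<comment> \<open>For negative \<open>z\<close> the default value \<open>lap 0 = 0\<close>
      exceeds \<open>z\<close>. This adds the point 0, a null set, to an interval that ends at
      1.\<close>
    have "z < lap u \<longleftrightarrow> u = 0 \<or> exp z / 2 < u" if "u \<in> {0..1}" for u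
      using that
    proof (cases rule: unit_interval_cases)
      case 2
      then have "z < ln (2 * u) \<longleftrightarrow> exp z < 2 * u"
        by (metis exp_less_cancel_iff exp_ln mult_pos_pos zero_less_numeral)
      then show ?thesis using 2 by (auto simp: lap_def)
    next
      case 3
      then have "ln (2 - 2 * u) < 0" by (intro ln_less_zero) auto
      then have "z < - ln (2 - 2 * u)" using True by linarith
      moreover have "exp z / 2 < u" using 3 \<open>exp z < 1\<close> by linarith
      ultimately show ?thesis using 3 by (simp add: lap_def)
    qed (use True \<open>exp z < 1\<close> \<open>exp z < 2\<close> in \<open>auto simp: lap_def\<close>)
    then have "{u \<in> {0..1}. z < lap u} = {u \<in> {0..1}. u = 0 \<or> exp z / 2 < u}"
      by blast
    moreover have "emeasure unif {u \<in> {0..1}. u = 0 \<or> e < u} = ennreal (1 - e)"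
      if "0 < e" "e \<le> 1" for e
    proof -
      have "{u \<in> {0..1}. u = 0 \<or> e < u} = insert 0 {e<..1}"
        using that by auto
      moreover have "emeasure unif (insert 0 {e<..1}) = emeasure lborel (insert 0 {e<..1})"
        using that by (intro sets) auto
      moreover have "emeasure lborel (insert 0 {e<..1}) = emeasure lborel {e<..1}"
        using that by (subst emeasure_insert) auto
      ultimately show ?thesis using that by simp
    qed
    from this[of "exp z / 2"] have "emeasure unif {u \<in> {0..1}. u = 0 \<or> exp z / 2 < u} = ennreal (1 - exp z / 2)"
      using \<open>exp z < 2\<close> by simp
    ultimately show ?thesis using True by simp
  next
    case False
    then have "exp (- z) \<le> 1" by simp
    then have "exp (- z) \<le> 2" by linarith
    \<comment> \<open>For nonnegative \<open>z\<close> the default value \<open>lap 1 = 0\<close>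
      does not exceed \<open>z\<close>, so the interval is open at 1.\<close>
    have "z < lap u \<longleftrightarrow> 1 - exp (- z) / 2 < u \<and> u < 1" if "u \<in> {0..1}" for u
      using that
    proof (cases rule: unit_interval_cases)
      case 2
      then have "ln (2 * u) \<le> 0" by simp
      then have "\<not> z < ln (2 * u)" using False by linarith
      moreover have "\<not> 1 - exp (- z) / 2 < u" using 2 \<open>exp (- z) \<le> 1\<close> by linarith
      ultimately show ?thesis using 2 by (simp add: lap_def)
    next
      case 3
      then have "z < - ln (2 - 2 * u) \<longleftrightarrow> ln (2 - 2 * u) < - z" by auto
      also have "\<dots> \<longleftrightarrow> 2 - 2 * u < exp (- z)"
        using 3 by (subst exp_less_cancel_iff[symmetric], subst exp_ln) auto
      finally show ?thesis using 3 by (auto simp: lap_def)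
    qed (use False \<open>exp (- z) \<le> 1\<close> \<open>exp (- z) \<le> 2\<close> in \<open>auto simp: lap_def\<close>)
    then have "{u \<in> {0..1}. z < lap u} = {u \<in> {0..1}. 1 - exp (- z) / 2 < u \<and> u < 1}"
      by blast
    also have "\<dots> = {1 - exp (- z) / 2<..<1}"
      using \<open>exp (- z) \<le> 2\<close> by auto
    finally have "emeasure unif {u \<in> {0..1}. z < lap u} = emeasure unif {1 - exp (- z) / 2<..<1}"
      by (rule arg_cong)
    also have "\<dots> = emeasure lborel {1 - exp (- z) / 2<..<1}"
      using \<open>exp (- z) \<le> 2\<close> by (intro sets) auto
    also have "\<dots> = ennreal (exp (- z) / 2)"
      by (subst emeasure_lborel_Ioo) auto
    finally show ?thesis using False by auto
  qed
  finally show "emeasure (distr unif borel lap) {z<..} = emeasure laplace {z<..}"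
    by (simp add: emeasure_laplace_greaterThan)
  then show "emeasure (distr unif borel lap) {z<..} < \<infinity>"
    by (simp add: emeasure_laplace_greaterThan)
qed (auto simp: laplace_def)

lemma prob_space_laplace: "prob_space laplace"
  unfolding distr_lap[symmetric]
  by (rule prob_space.prob_space_distr[OF prob_space_unif]) measurable

lemma sets_laplace [measurable_cong]: "sets laplace = sets borel"
  by (simp add: laplace_def)

section \<open>The cost of shifting Laplace noise\<close>

text \<open>Substituting \<open>\<delta> + x\<close> for \<open>x\<close>, with
  \<open>\<delta> = (c' - c) / b\<close>, turns the centre \<open>c\<close> into \<open>c'\<close>
  and moves the shift into the density, where the triangle inequality bounds it by the factor
  \<open>exp \<bar>\<delta>\<bar>\<close>. Without noise, for \<open>b = 0\<close>, the centres
  coincide and division by zero makes the factor 1.\<close>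

lemma laplace_shift:
  fixes b c c' :: real
  assumes [measurable]: "f \<in> borel_measurable borel" and "0 \<le> b" and b0: "b = 0 \<Longrightarrow> c = c'"
  shows "(\<integral>\<^sup>+x. f (c + b * x) \<partial>laplace)
    \<le> ennreal (exp (\<bar>c - c'\<bar> / b)) * (\<integral>\<^sup>+x. f (c' + b * x) \<partial>laplace)"
proof (cases "b = 0")
  case True
  then show ?thesis using b0 by simp
next
  case False
  then have "b > 0" using assms by simp
  define \<delta> where "\<delta> = (c' - c) / b"
  have \<delta>: "c + b * (\<delta> + x) = c' + b * x" "\<bar>\<delta>\<bar> = \<bar>c - c'\<bar> / b" for x
    using \<open>b > 0\<close> by (auto simp: \<delta>_def field_simps abs_minus_commute)
  have "(\<integral>\<^sup>+x. f (c + b * x) \<partial>laplace)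
      = (\<integral>\<^sup>+x. ennreal (exp (- \<bar>x\<bar>) / 2) * f (c + b * x) \<partial>lborel)"
    unfolding laplace_def by (subst nn_integral_density) auto
  also have "\<dots> = (\<integral>\<^sup>+x. ennreal (exp (- \<bar>\<delta> + x\<bar>) / 2) * f (c' + b * x) \<partial>lborel)"
    by (subst nn_integral_real_affine[where c = 1 and t = \<delta>]) (simp_all add: \<delta>)
  also have "\<dots> \<le> (\<integral>\<^sup>+x. ennreal (exp \<bar>\<delta>\<bar>) * (ennreal (exp (- \<bar>x\<bar>) / 2) * f (c' + b * x)) \<partial>lborel)"
  proof (rule nn_integral_mono)
    fix x :: real
    have "exp (- \<bar>\<delta> + x\<bar>) / 2 \<le> exp \<bar>\<delta>\<bar> * (exp (- \<bar>x\<bar>) / 2)"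
      by (simp flip: exp_add)
    then have "ennreal (exp (- \<bar>\<delta> + x\<bar>) / 2) \<le> ennreal (exp \<bar>\<delta>\<bar>) * ennreal (exp (- \<bar>x\<bar>) / 2)"
      by (simp add: ennreal_mult'[symmetric])
    then show "ennreal (exp (- \<bar>\<delta> + x\<bar>) / 2) * f (c' + b * x)
        \<le> ennreal (exp \<bar>\<delta>\<bar>) * (ennreal (exp (- \<bar>x\<bar>) / 2) * f (c' + b * x))"
      by (metis mult.assoc mult_right_mono zero_le)
  qed
  also have "\<dots> = ennreal (exp \<bar>\<delta>\<bar>) * (\<integral>\<^sup>+x. f (c' + b * x) \<partial>laplace)"
    unfolding laplace_def by (subst nn_integral_density) (auto simp: nn_integral_cmult)
  finally show ?thesis by (simp add: \<delta>)
qed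

text \<open>Fubini, one coordinate at a time: the one-dimensional factors multiply, so their
  exponents add up to the L1 distance of the centres.\<close>

lemma laplace_shift_PiM:
  fixes b :: real and c c' :: "'i \<Rightarrow> real"
  assumes "finite I" and "0 \<le> b" and "\<And>i. i \<in> I \<Longrightarrow> b = 0 \<Longrightarrow> c i = c' i"
    and "f \<in> borel_measurable (\<Pi>\<^sub>M i\<in>I. borel)"
  shows "(\<integral>\<^sup>+z. f (\<lambda>i\<in>I. c i + b * z i) \<partial>(\<Pi>\<^sub>M i\<in>I. laplace))
    \<le> ennreal (exp ((\<Sum>i\<in>I. \<bar>c i - c' i\<bar>) / b)) * (\<integral>\<^sup>+z. f (\<lambda>i\<in>I. c' i + b * z i) \<partial>(\<Pi>\<^sub>M i\<in>I. laplace))"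
  using assms(1,3,4)
proof (induction I arbitrary: f)
  case empty
  then show ?case by simp
next
  case (insert i I)
  interpret product_prob_space "\<lambda>_::'i. laplace"
    by (simp add: product_prob_spaceI prob_space_laplace)
  note [measurable] = insert.prems(2)
  have upd: "(\<lambda>j\<in>insert i I. a j + b * (z(i := y)) j) = (\<lambda>j\<in>I. a j + b * z j)(i := a i + b * y)" for a z y
    using insert.hyps by (auto simp: fun_eq_iff)
  \<comment> \<open>The new coordinate is integrated out with its centre already moved to
    \<open>c' i\<close>. The induction hypothesis, which holds for all integrands, is then applied
    to \<open>g\<close>.\<close>
  define g where "g = (\<lambda>x. \<integral>\<^sup>+y. f (x(i := c' i + b * y)) \<partial>laplace)"
  have g [measurable]: "g \<in> borel_measurable (\<Pi>\<^sub>M i\<in>I. borel)"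
    unfolding g_def by measurable
  have fold: "(\<integral>\<^sup>+z. f (\<lambda>j\<in>insert i I. a j + b * z j) \<partial>(\<Pi>\<^sub>M i\<in>insert i I. laplace))
     = (\<integral>\<^sup>+z. \<integral>\<^sup>+y. f ((\<lambda>j\<in>I. a j + b * z j)(i := a i + b * y)) \<partial>laplace \<partial>(\<Pi>\<^sub>M i\<in>I. laplace))" for a
    by (subst product_nn_integral_insert[OF insert.hyps]) (measurable, simp only: upd)
  let ?e = "\<lambda>I. ennreal (exp ((\<Sum>i\<in>I. \<bar>c i - c' i\<bar>) / b))"
  let ?e1 = "ennreal (exp (\<bar>c i - c' i\<bar> / b))"
  have "(\<integral>\<^sup>+z. f (\<lambda>j\<in>insert i I. c j + b * z j) \<partial>(\<Pi>\<^sub>M i\<in>insert i I. laplace))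
     \<le> (\<integral>\<^sup>+z. ?e1 * g (\<lambda>j\<in>I. c j + b * z j) \<partial>(\<Pi>\<^sub>M i\<in>I. laplace))"
    unfolding fold
  proof (rule nn_integral_mono)
    fix z
    have "(\<lambda>j\<in>I. c j + b * z j) \<in> space (\<Pi>\<^sub>M i\<in>I. borel)"
      by (simp add: space_PiM)
    then have [measurable]: "(\<lambda>x. f ((\<lambda>j\<in>I. c j + b * z j)(i := x))) \<in> borel_measurable borel"
      using measurable_component_update[of "\<lambda>j\<in>I. c j + b * z j" I "\<lambda>_. borel" i] insert.hyps
        measurable_compose[OF _ insert.prems(2)] by auto
    show "(\<integral>\<^sup>+y. f ((\<lambda>j\<in>I. c j + b * z j)(i := c i + b * y)) \<partial>laplace) \<le> ?e1 * g (\<lambda>j\<in>I. c j + b * z j)"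
      unfolding g_def using assms(2) insert.prems(1)[of i]
      by (intro laplace_shift[where f = "\<lambda>x. f ((\<lambda>j\<in>I. c j + b * z j)(i := x))"]) auto
  qed
  also have "\<dots> = ?e1 * (\<integral>\<^sup>+z. g (\<lambda>j\<in>I. c j + b * z j) \<partial>(\<Pi>\<^sub>M i\<in>I. laplace))"
    by (rule nn_integral_cmult) measurable
  also have "\<dots> \<le> ?e1 * (?e I * (\<integral>\<^sup>+z. g (\<lambda>j\<in>I. c' j + b * z j) \<partial>(\<Pi>\<^sub>M i\<in>I. laplace)))"
    using insert.prems by (intro mult_left_mono insert.IH) auto
  also have "\<dots> = ?e (insert i I) * (\<integral>\<^sup>+z. g (\<lambda>j\<in>I. c' j + b * z j) \<partial>(\<Pi>\<^sub>M i\<in>I. laplace))"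
    using insert.hyps by (simp add: add_divide_distrib exp_add ennreal_mult' mult.assoc)
  finally show ?case unfolding fold g_def .
qed

section \<open>Tail bound and joint law of the noise\<close>

text \<open>Values of \<open>lap\<close> beyond \<open>s\<close> arise only within distance
  \<open>exp (- s) / 2\<close> of an end point of the unit interval, and the two end segments have
  total length \<open>exp (- s)\<close>.\<close>

lemma unif_lap_tail:
  assumes "0 \<le> s"
  shows "measure unif {u \<in> space unif. s < \<bar>lap u\<bar>} \<le> exp (- s)"
proof -
  have "exp (- s) \<le> 1" using assms by simp
  then have e: "exp (- s) \<le> 2" by linarith
  have "u \<in> {0..exp (- s) / 2} \<union> {1 - exp (- s) / 2..1}" if u: "u \<in> {0..1}" "s < \<bar>lap u\<bar>" for u
    using u(1)
  proof (cases rule: unit_interval_cases)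
    case 2
    then have "ln (2 * u) \<le> 0" by simp
    then have "ln (2 * u) < - s" using 2 u by (simp add: lap_def)
    then have "2 * u < exp (- s)" using 2 by (metis exp_less_cancel_iff exp_ln zero_less_mult_iff zero_less_numeral)
    then show ?thesis using 2 by simp
  next
    case 3
    then have "ln (2 - 2 * u) \<le> 0" by simp
    then have "ln (2 - 2 * u) < - s" using 3 u by (simp add: lap_def)
    moreover have "0 < 2 - 2 * u" using 3 by simp
    ultimately have "2 - 2 * u < exp (- s)" by (metis exp_less_cancel_iff exp_ln)
    then show ?thesis using 3 by simp
  qed (use e in auto)
  then have "{u \<in> space unif. s < \<bar>lap u\<bar>} \<subseteq> {0..exp (- s) / 2} \<union> {1 - exp (- s) / 2..1}"
    unfolding space_unif by blast
  moreover have sets: "{0..exp (- s) / 2} \<in> sets unif" "{1 - exp (- s) / 2..1} \<in> sets unif"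
    using e by (auto simp: unif_def sets_restrict_space_iff)
  ultimately have "measure unif {u \<in> space unif. s < \<bar>lap u\<bar>}
      \<le> measure unif ({0..exp (- s) / 2} \<union> {1 - exp (- s) / 2..1})"
    using prob_space_unif by (intro finite_measure.finite_measure_mono prob_space.finite_measure) auto
  also have "\<dots> \<le> measure unif {0..exp (- s) / 2} + measure unif {1 - exp (- s) / 2..1}"
    using sets by (rule measure_Un_le)
  also have "\<dots> = exp (- s)"
    using e by (simp add: unif_def measure_restrict_space)
  finally show ?thesis .
qed

text \<open>Restricting the infinite tape to its first \<open>N\<close> entries gives a finite
  product of uniform laws, and a coordinatewise map sends a product measure to the product of the
  image measures.\<close>

lemma distr_tape_lap:
  "distr tape (RN N) (\<lambda>\<omega>. \<lambda>i\<in>{..<N}. lap (\<omega> i)) = (\<Pi>\<^sub>M i\<in>{..<N}. laplace)"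
proof -
  interpret product_prob_space "\<lambda>_::nat. unif" UNIV
    by (simp add: product_prob_spaceI prob_space_unif)
  have lap_PiM: "compose {..<N} lap \<in> (\<Pi>\<^sub>M i\<in>{..<N}. unif) \<rightarrow>\<^sub>M (\<Pi>\<^sub>M i\<in>{..<N}. borel)"
    unfolding compose_def by measurable
  have tape: "tape = (\<Pi>\<^sub>M i\<in>UNIV. unif)" by (simp add: tape_def unif_def)
  have "distr tape (RN N) (\<lambda>\<omega>. \<lambda>i\<in>{..<N}. lap (\<omega> i))
     = distr (distr tape (\<Pi>\<^sub>M i\<in>{..<N}. unif) (\<lambda>\<omega>. restrict \<omega> {..<N})) (RN N) (compose {..<N} lap)"
    using lap_PiM unfolding tape RN_def
    by (subst distr_distr) (measurable, auto simp: compose_def o_def intro!: distr_cong)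
  also have "distr tape (\<Pi>\<^sub>M i\<in>{..<N}. unif) (\<lambda>\<omega>. restrict \<omega> {..<N}) = (\<Pi>\<^sub>M i\<in>{..<N}. unif)"
    unfolding tape by (rule distr_PiM_restrict_finite) auto
  \<comment> \<open>Only the name of the target space changes: \<open>laplace\<close> has the Borel
    sets, and the image theorem for finite products wants probability spaces on both sides.\<close>
  also have "distr \<dots> (RN N) (compose {..<N} lap)
      = distr (\<Pi>\<^sub>M i\<in>{..<N}. unif) (\<Pi>\<^sub>M i\<in>{..<N}. laplace) (compose {..<N} lap)"
    unfolding RN_def by (rule distr_cong) (auto intro!: sets_PiM_cong simp: sets_laplace)
  also have "\<dots> = (\<Pi>\<^sub>M i\<in>{..<N}. distr unif laplace lap)"
    by (rule distr_PiM_finite_prob_space')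
       (auto intro: prob_space_unif prob_space_laplace simp: measurable_cong_sets[OF refl sets_laplace])
  also have "distr unif laplace lap = distr unif borel lap"
    by (rule distr_cong) (auto simp: sets_laplace)
  finally show ?thesis by (simp only: distr_lap)
qed


lemma prob_space_tape: "prob_space tape"
  unfolding tape_def unif_def[symmetric] by (intro prob_space_PiM prob_space_unif)

lemma lap_tape_measurable [measurable]: "(\<lambda>\<omega>. lap (\<omega> i)) \<in> borel_measurable tape"
  unfolding tape_def unif_def[symmetric] by measurable

section \<open>The Laplace mechanism\<close>

text \<open>The Laplace mechanism with centre \<open>c\<close> and scale \<open>b\<close>, as a
  random variable on the tape. Coordinate \<open>i\<close> uses draw \<open>i\<close>, the order in
  which the sanitizer reads the tape.\<close>

definition noisy :: "nat \<Rightarrow> real \<Rightarrow> (nat \<Rightarrow> real) \<Rightarrow> (nat \<Rightarrow> real) \<Rightarrow> nat \<Rightarrow> real" where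
  "noisy N b c \<omega> = (\<lambda>i\<in>{..<N}. c i + b * lap (\<omega> i))"

lemma noisy_measurable [measurable]: "noisy N b c \<in> tape \<rightarrow>\<^sub>M RN N"
  unfolding noisy_def RN_def by measurable

text \<open>Privacy of the mechanism: the shift bound for the indicator of \<open>S\<close>, where
  \<open>\<epsilon>\<close> bounds the L1 distance of the centres in units of the scale.\<close>

lemma measure_noisy_le:
  assumes "0 \<le> b" and "\<And>i. i < N \<Longrightarrow> b = 0 \<Longrightarrow> c i = c' i"
    and \<epsilon>: "(\<Sum>i<N. \<bar>c i - c' i\<bar>) / b \<le> \<epsilon>" and S: "S \<in> sets (RN N)"
  shows "measure (distr tape (RN N) (noisy N b c)) S
    \<le> exp \<epsilon> * measure (distr tape (RN N) (noisy N b c')) S"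
proof -
  let ?I = "{..<N}" and ?L = "\<Pi>\<^sub>M i\<in>{..<N}. laplace"
  have ind: "(indicator S :: _ \<Rightarrow> ennreal) \<in> borel_measurable (RN N)"
    using S by simp
  \<comment> \<open>The probability becomes an integral against independent standard Laplace
    variables, with centre and scale moved into the integrand, where the shift bound acts.\<close>
  have eq: "emeasure (distr tape (RN N) (noisy N b a)) S
      = (\<integral>\<^sup>+z. indicator S (\<lambda>i\<in>?I. a i + b * z i) \<partial>?L)" for a
  proof -
    have m: "(\<lambda>z. \<lambda>i\<in>?I. a i + b * z i) \<in> RN N \<rightarrow>\<^sub>M RN N"
      unfolding RN_def by measurable
    have l: "(\<lambda>\<omega>. \<lambda>i\<in>?I. lap (\<omega> i)) \<in> tape \<rightarrow>\<^sub>M RN N"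
      unfolding RN_def by measurable
    have "emeasure (distr tape (RN N) (noisy N b a)) S
        = (\<integral>\<^sup>+\<omega>. indicator S (noisy N b a \<omega>) \<partial>tape)"
      using ind by (subst nn_integral_distr[OF noisy_measurable, symmetric]) (simp_all add: S)
    also have "\<dots> = (\<integral>\<^sup>+\<omega>. indicator S (\<lambda>i\<in>?I. a i + b * (\<lambda>i\<in>?I. lap (\<omega> i)) i) \<partial>tape)"
      by (simp add: noisy_def cong: restrict_cong)
    also have "\<dots> = (\<integral>\<^sup>+z. indicator S (\<lambda>i\<in>?I. a i + b * z i) \<partial>distr tape (RN N) (\<lambda>\<omega>. \<lambda>i\<in>?I. lap (\<omega> i)))"
      using measurable_compose[OF m ind] by (subst nn_integral_distr[OF l]) auto
    finally show ?thesis by (simp only: distr_tape_lap)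
  qed
  have "emeasure (distr tape (RN N) (noisy N b c)) S
      \<le> ennreal (exp ((\<Sum>i<N. \<bar>c i - c' i\<bar>) / b)) * emeasure (distr tape (RN N) (noisy N b c')) S"
    unfolding eq using assms(1,2) ind[unfolded RN_def]
    by (intro laplace_shift_PiM[where f = "indicator S"]) auto
  also have "\<dots> \<le> ennreal (exp \<epsilon>) * emeasure (distr tape (RN N) (noisy N b c')) S"
    using \<epsilon> by (intro mult_right_mono ennreal_leI) auto
  finally show ?thesis
    using prob_space.finite_measure[OF prob_space.prob_space_distr[OF prob_space_tape noisy_measurable]]
    by (simp add: finite_measure.emeasure_eq_measure ennreal_mult'[symmetric])
qed

text \<open>A union bound over the \<open>N\<close> events that a single noise variable exceeds
  \<open>s\<close>; outside them the output lies in \<open>S\<close>.\<close>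

lemma noisy_concentration:
  assumes "0 \<le> s" and S: "S \<in> sets (RN N)"
    and in_S: "\<And>\<omega>. \<omega> \<in> space tape \<Longrightarrow> \<forall>i<N. \<bar>lap (\<omega> i)\<bar> \<le> s \<Longrightarrow> noisy N b c \<omega> \<in> S"
  shows "1 - real N * exp (- s) \<le> measure (distr tape (RN N) (noisy N b c)) S"
proof -
  interpret prob_space tape by (rule prob_space_tape)
  define Bad where "Bad i = {\<omega> \<in> space tape. s < \<bar>lap (\<omega> i)\<bar>}" for i
  have Bad [measurable]: "Bad i \<in> sets tape" for i
    unfolding Bad_def by measurable
  have "measure tape (Bad i) \<le> exp (- s)" for i
  proof -
    \<comment> \<open>A bad event depends on one draw, so its probability is computed from the
      uniform marginal of the tape.\<close>
    have comp: "(\<lambda>\<omega>. \<omega> i) \<in> tape \<rightarrow>\<^sub>M unif" "distr tape unif (\<lambda>\<omega>. \<omega> i) = unif"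
      unfolding tape_def unif_def[symmetric]
      by (auto intro!: distr_PiM_component prob_space_unif)
    have "measure tape (Bad i) = measure (distr tape unif (\<lambda>\<omega>. \<omega> i)) {u \<in> space unif. s < \<bar>lap u\<bar>}"
      using measurable_space[OF comp(1)]
      by (subst measure_distr[OF comp(1)]) (auto simp: Bad_def intro!: arg_cong[where f = "measure tape"])
    then show ?thesis using unif_lap_tail[OF assms(1)] comp by simp
  qed
  then have "(\<Sum>i<N. measure tape (Bad i)) \<le> real N * exp (- s)"
    using sum_bounded_above[of "{..<N}" "\<lambda>i. measure tape (Bad i)" "exp (- s)"] by simp
  moreover have "measure tape (\<Union>i<N. Bad i) \<le> (\<Sum>i<N. measure tape (Bad i))"
    by (rule finite_measure_subadditive_finite) auto
  ultimately have "measure tape (\<Union>i<N. Bad i) \<le> real N * exp (- s)"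
    by linarith
  then have "1 - real N * exp (- s) \<le> measure tape (space tape - (\<Union>i<N. Bad i))"
    by (subst prob_compl) auto
  also have "\<dots> \<le> measure tape (noisy N b c -` S \<inter> space tape)"
    using S by (intro finite_measure_mono) (auto simp: Bad_def not_less intro!: in_S)
  also have "\<dots> = measure (distr tape (RN N) (noisy N b c)) S"
    using S by (simp add: measure_distr)
  finally show ?thesis .
qed

section \<open>Programs\<close>

text \<open>
  With these variants of the evaluation rules, programs can be run by first-order unification
  alone, so that values and costs may be left schematic.
\<close>

lemma eval_Var_0: "eval \<omega> F (v # \<rho>) (TVar 0) i v i 1"
  using eval_Var[of 0 "v # \<rho>"] by simp

lemma eval_Var_1: "eval \<omega> F (u # v # \<rho>) (TVar 1) i v i 1"
  using eval_Var[of 1 "u # v # \<rho>"] by simp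

lemma eval_Var_2: "eval \<omega> F (u # u' # v # \<rho>) (TVar 2) i v i 1"
  using eval_Var[of 2 "u # u' # v # \<rho>"] by simp

lemma eval_IfLe_le:
  "\<lbrakk>eval \<omega> F \<rho> a i (VReal r) j c1; eval \<omega> F \<rho> b j (VReal s) k c2; r \<le> s;
     eval \<omega> F \<rho> e1 k v l c3\<rbrakk> \<Longrightarrow> eval \<omega> F \<rho> (TIfLe a b e1 e2) i v l (c1 + c2 + c3 + 1)"
  by (rule eval_IfLe) auto

lemma eval_IfLe_gt:
  "\<lbrakk>eval \<omega> F \<rho> a i (VReal r) j c1; eval \<omega> F \<rho> b j (VReal s) k c2; r > s;
     eval \<omega> F \<rho> e2 k v l c3\<rbrakk> \<Longrightarrow> eval \<omega> F \<rho> (TIfLe a b e1 e2) i v l (c1 + c2 + c3 + 1)"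
  by (rule eval_IfLe) auto

text \<open>Applied first, this makes value, tape position and cost schematic; once the rules have
  computed them, only equations with the claimed ones remain.\<close>

lemma eval_cong:
  "eval \<omega> F \<rho> e i v j c \<Longrightarrow> v = v' \<Longrightarrow> j = j' \<Longrightarrow> c = c' \<Longrightarrow> eval \<omega> F \<rho> e i v' j' c'"
  by simp

lemmas eval_simple = eval_Var_0 eval_Var_1 eval_Var_2 eval_Num eval_Nil eval_Cons eval_Head
  eval_Tail eval_Op eval_Ln eval_Let eval_Unif

section \<open>The program of the sanitizer\<close>

text \<open>Neither \<open>n\<close> nor \<open>N\<close> is an entry of the input, so the sanitizer
  counts rows and coefficients.\<close>

definition len_prog :: tm where
  "len_prog = TIfNil (TVar 0) (TNum 0) (TOp Add (TNum 1) (TSelf (TTail (TVar 0))))"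

lemma eval_len_prog:
  "eval \<omega> len_prog [vlist vs] len_prog i (VReal (real (length vs))) i (7 * length vs + 3)"
proof (induction vs)
  case Nil
  have "eval \<omega> len_prog [VNil] (TIfNil (TVar 0) (TNum 0) (TOp Add (TNum 1) (TSelf (TTail (TVar 0))))) i (VReal 0) i 3"
    by (rule eval_cong, (rule eval_IfNil_Nil eval_simple)+) simp_all
  then show ?case by (simp add: len_prog_def)
next
  case (Cons v vs)
  have "eval \<omega> len_prog [VCons v (vlist vs)] (TIfNil (TVar 0) (TNum 0) (TOp Add (TNum 1) (TSelf (TTail (TVar 0))))) i
    (VReal (real (length (v # vs)))) i (7 * length (v # vs) + 3)"
    by (rule eval_cong, (rule eval_IfNil_Cons eval_Self Cons.IH eval_simple)+) simp_all
  then show ?case by (simp add: len_prog_def)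
qed

definition add_prog :: tm where
  "add_prog = TIfNil (THead (TVar 0)) TNil
     (TCons (TOp Add (THead (THead (TVar 0))) (THead (TTail (TVar 0))))
       (TSelf (TCons (TTail (THead (TVar 0))) (TTail (TTail (TVar 0))))))"

abbreviation vreals :: "real list \<Rightarrow> val" where
  "vreals rs \<equiv> vlist (map VReal rs)"

lemma eval_add_prog:
  "length rs = length ss \<Longrightarrow> eval \<omega> add_prog [VCons (vreals rs) (vreals ss)] add_prog i
     (vreals (map2 (+) rs ss)) i (19 * length rs + 4)"
proof (induction rs ss rule: list_induct2)
  case Nil
  have "eval \<omega> F [VCons VNil VNil] add_prog i VNil i 4" for F
    unfolding add_prog_def by (rule eval_cong, (rule eval_IfNil_Nil eval_simple)+) simp_all
  then show ?case by simp
next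
  case (Cons r rs s ss)
  have "eval \<omega> add_prog [VCons (VCons (VReal r) (vreals rs)) (VCons (VReal s) (vreals ss))]
     (TIfNil (THead (TVar 0)) TNil
     (TCons (TOp Add (THead (THead (TVar 0))) (THead (TTail (TVar 0))))
       (TSelf (TCons (TTail (THead (TVar 0))) (TTail (TTail (TVar 0)))))))
     i (VCons (VReal (r + s)) (vreals (map2 (+) rs ss))) i (19 * length (r # rs) + 4)"
    by (rule eval_cong, (rule eval_IfNil_Cons eval_Self Cons.IH eval_simple)+) simp_all
  then show ?case by (simp add: add_prog_def)
qed


text \<open>The recursion stops at the last row instead of the empty list, which avoids building a
  zero vector but calls for a nonempty database.\<close>

definition rows_prog :: "tm \<Rightarrow> tm" where
  "rows_prog P = TIfNil (TTail (TTail (TVar 0)))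
     (TCall P (TCons (THead (TVar 0)) (THead (TTail (TVar 0)))))
     (TCall add_prog
       (TCons (TCall P (TCons (THead (TVar 0)) (THead (TTail (TVar 0)))))
         (TSelf (TCons (THead (TVar 0)) (TTail (TTail (TVar 0)))))))"

text \<open>\<open>P\<close> leaves the tape position \<open>i\<close> unchanged, so one hypothesis
  about position \<open>i\<close> serves every row.\<close>

lemma eval_rows_prog:
  assumes "D \<noteq> []"
    and "\<And>x. x \<in> set D \<Longrightarrow> eval \<omega> P [VCons inst (vbits x)] P i (vreals (map (p x) [0..<N])) i (c x)"
  shows "\<exists>k. eval \<omega> (rows_prog P) [VCons inst (vdb D)] (rows_prog P) i
      (vreals (map (\<lambda>j. \<Sum>x\<leftarrow>D. p x j) [0..<N])) i k
    \<and> k \<le> (\<Sum>x\<leftarrow>D. c x) + (19 * N + 24) * length D"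
  using assms
proof (induction D rule: list_nonempty_induct)
  case (single x)
  have "eval \<omega> (rows_prog P) [VCons inst (VCons (vbits x) VNil)] (rows_prog P) i
      (vreals (map (p x) [0..<N])) i (11 + c x)"
    by (subst (2) rows_prog_def, rule eval_cong,
        (rule eval_IfNil_Nil eval_Call single eval_simple | simp; fail)+)
  then show ?case by (intro exI[of _ "11 + c x"]) (simp add: vdb_def)
next
  case (cons x D)
  then obtain k where k: "eval \<omega> (rows_prog P) [VCons inst (vdb D)] (rows_prog P) i
      (vreals (map (\<lambda>j. \<Sum>x\<leftarrow>D. p x j) [0..<N])) i k" "k \<le> (\<Sum>x\<leftarrow>D. c x) + (19 * N + 24) * length D"
    by fastforce
  \<comment> \<open>The recursive branch is entered only when the remaining rows visibly start with
    a cons cell.\<close>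
  obtain y E where D: "D = y # E" using cons.hyps by (cases D) auto
  then have vD: "vdb D = VCons (vbits y) (vdb E)" by (simp add: vdb_def)
  note add = eval_add_prog[of "map (p x) [0..<N]" "map (\<lambda>j. \<Sum>x\<leftarrow>D. p x j) [0..<N]", simplified length_map refl simp_thms]
  have "eval \<omega> (rows_prog P) [VCons inst (VCons (vbits x) (vdb D))] (rows_prog P) i
      (vreals (map (\<lambda>j. \<Sum>x\<leftarrow>x # D. p x j) [0..<N])) i (c x + k + 19 * N + 24)"
    unfolding vD
    by (subst (2) rows_prog_def, rule eval_cong,
        (rule eval_IfNil_Cons eval_Call eval_Self k(1)[unfolded vD] cons.prems add eval_simple
          | simp add: map2_map_map o_def; fail)+)
  then show ?case
    using k(2) by (intro exI[of _ "c x + k + 19 * N + 24"]) (simp add: vdb_def algebra_simps)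
qed

text \<open>The operations with 0 in the first branch make both branches equally expensive.\<close>

definition lap_tm :: tm where
  "lap_tm = TLet TUnif (TIfLe (TOp Add (TVar 0) (TVar 0)) (TNum 1)
     (TOp Sub (TLn (TOp Sub (TOp Add (TVar 0) (TVar 0)) (TNum 0))) (TNum 0))
     (TOp Sub (TNum 0) (TLn (TOp Sub (TNum 2) (TOp Add (TVar 0) (TVar 0))))))"

lemma eval_lap_tm: "eval \<omega> F \<rho> lap_tm i (VReal (lap (\<omega> i))) (Suc i) 15"
proof (cases "2 * \<omega> i \<le> 1")
  case True
  then show ?thesis unfolding lap_tm_def
    by - (rule eval_cong, (rule eval_IfLe_le eval_simple | simp add: lap_def; fail)+)
next
  case False
  then show ?thesis unfolding lap_tm_def
    by - (rule eval_cong, (rule eval_IfLe_gt eval_simple | simp add: lap_def; fail)+)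
qed

text \<open>The input packs the scale, the number of rows and the coefficient sums. Sums are turned
  into means in the same pass that adds the noise.\<close>

definition noise_prog :: tm where
  "noise_prog = TIfNil (TTail (TTail (TVar 0))) TNil
     (TCons
       (TOp Add (TOp Div (THead (TTail (TTail (TVar 0)))) (THead (TTail (TVar 0))))
         (TOp Mul (THead (TVar 0)) lap_tm))
       (TSelf (TCons (THead (TVar 0))
         (TCons (THead (TTail (TVar 0))) (TTail (TTail (TTail (TVar 0))))))))"

text \<open>Each coefficient consumes one draw, so the induction runs over all start positions
  \<open>i\<close>.\<close>

lemma eval_noise_prog:
  "eval \<omega> noise_prog [VCons (VReal b) (VCons (VReal n) (vreals rs))] noise_prog i
     (vreals (map (\<lambda>k. rs ! k / n + b * lap (\<omega> (i + k))) [0..<length rs])) (i + length rs)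
     (44 * length rs + 5)"
proof (induction rs arbitrary: i)
  case Nil
  show ?case
    by (subst (2) noise_prog_def, rule eval_cong, unfold list.map vlist.simps,
        (rule eval_IfNil_Nil eval_simple | simp; fail)+)
next
  case (Cons r rs)
  show ?case
    by (subst (2) noise_prog_def, rule eval_cong, unfold list.map(2) vlist.simps,
        (rule eval_IfNil_Cons eval_Self eval_lap_tm Cons.IH eval_simple
          | simp add: map_upt_Suc del: upt_Suc; fail)+)
qed

text \<open>The outer \<open>TLet\<close> sums the rows before anything is drawn. The scale
  \<open>2 T N / (\<epsilon> n)\<close> is computed afterwards; \<open>T\<close> is the fifth entry
  of the instance.\<close>

definition san_prog :: "tm \<Rightarrow> tm" where
  "san_prog P =
     TLet (TCall (rows_prog P) (TCons (THead (TVar 0)) (TTail (TTail (TVar 0)))))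
       (TCall noise_prog
         (TCons
           (TOp Div
             (TOp Mul (TOp Mul (TNum 2) (THead (TTail (TTail (TTail (TTail (THead (TVar 1))))))))
               (TCall len_prog (TVar 0)))
             (TOp Mul (THead (TTail (TVar 1))) (TCall len_prog (TTail (TTail (TVar 1))))))
           (TCons (TCall len_prog (TTail (TTail (TVar 1)))) (TVar 0))))"

lemma runs_san_prog:
  assumes "D \<noteq> []"
    and P: "\<And>x. x \<in> set D \<Longrightarrow> runs_det P (VCons (vinst \<iota> d m t T) (vbits x)) (vvec N (p x)) (c x)"
  shows "\<exists>k. runs \<omega> (san_prog P) (VCons (vinst \<iota> d m t T) (VCons (VReal \<epsilon>) (vdb D)))
      (vvec N (noisy N (2 * T * real N / (\<epsilon> * real (length D)))
        (\<lambda>j. (\<Sum>x\<leftarrow>D. p x j) / real (length D)) \<omega>)) k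
    \<and> k \<le> (\<Sum>x\<leftarrow>D. c x) + (19 * N + 38) * length D + 51 * N + 100"
proof -
  let ?s = "map (\<lambda>j. \<Sum>x\<leftarrow>D. p x j) [0..<N]"
  \<comment> \<open>Position 0 is the one at which \<open>runs_det\<close> describes
    \<open>P\<close>.\<close>
  have "\<exists>k. eval \<omega> (rows_prog P) [VCons (vinst \<iota> d m t T) (vdb D)] (rows_prog P) 0
      (vreals ?s) 0 k \<and> k \<le> (\<Sum>x\<leftarrow>D. c x) + (19 * N + 24) * length D"
    using P by (intro eval_rows_prog assms(1)) (simp add: runs_det_def vvec_def o_def)
  then obtain k where k: "eval \<omega> (rows_prog P) [VCons (vinst \<iota> d m t T) (vdb D)] (rows_prog P) 0
      (vreals ?s) 0 k" "k \<le> (\<Sum>x\<leftarrow>D. c x) + (19 * N + 24) * length D"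
    by blast
  note len_D = eval_len_prog[of \<omega> "map vbits D", folded vdb_def]
  note len_s = eval_len_prog[of \<omega> "map VReal ?s"]
  \<comment> \<open>Counting the database twice costs 14 steps per row. A coefficient costs 51: 7
    for counting it and 44 for its noise.\<close>
  have "eval \<omega> (san_prog P) [VCons (vinst \<iota> d m t T) (VCons (VReal \<epsilon>) (vdb D))] (san_prog P) 0
      (vvec N (noisy N (2 * T * real N / (\<epsilon> * real (length D)))
        (\<lambda>j. (\<Sum>x\<leftarrow>D. p x j) / real (length D)) \<omega>)) N
      (k + 14 * length D + 51 * N + 51)"
    by (subst (2) san_prog_def, rule eval_cong, rule eval_Let, rule eval_Call, (rule eval_simple)+,
        rule k(1), unfold vinst_def vlist.simps,
        (rule eval_Call eval_noise_prog len_D len_s eval_simple)+,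
        unfold vvec_def noisy_def, rule arg_cong[where f = vlist])
       simp_all
  then show ?thesis
    using k(2) unfolding runs_def by (intro exI[of _ "k + 14 * length D + 51 * N + 51"]) (auto simp: algebra_simps)
qed

section \<open>Recursive evaluation of polynomials\<close>

text \<open>
  The input consists of \<open>m\<close>, \<open>t\<close>, \<open>y\<close> and a list of coefficients, of which a prefix of
  length \<open>N\<close> is consumed; the output is the value of the polynomial followed by the remaining
  coefficients.  For \<open>m = 0\<close> or \<open>t = 0\<close> the polynomial is constant, and this output is the
  list of coefficients itself.
\<close>

definition ev_prog :: tm where
  "ev_prog =
     TIfLe (THead (TVar 0)) (TNum 0) (TTail (TTail (TTail (TVar 0))))
       (TIfLe (THead (TTail (TVar 0))) (TNum 0) (TTail (TTail (TTail (TVar 0))))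
         (TLet (TSelf
             (TCons (TOp Sub (THead (TVar 0)) (TNum 1))
               (TCons (THead (TTail (TVar 0)))
                 (TCons (TTail (THead (TTail (TTail (TVar 0))))) (TTail (TTail (TTail (TVar 0))))))))
           (TLet (TSelf
               (TCons (THead (TVar 1))
                 (TCons (TOp Sub (THead (TTail (TVar 1))) (TNum 1))
                   (TCons (THead (TTail (TTail (TVar 1)))) (TTail (TVar 0))))))
             (TCons (TOp Add (THead (TVar 1))
                 (TOp Mul (THead (THead (TTail (TTail (TVar 2))))) (THead (TVar 0))))
               (TTail (TVar 0))))))"

lemma poly_eval_0_left: "poly_eval 0 t p y = p 0"
  by (simp add: poly_eval_def)

lemma poly_eval_0_right: "poly_eval m 0 p y = p 0"
proof (cases m)
  case (Suc n)
  have "(\<Prod>j<Suc n. (of_bool (y ! j) :: real) ^ (replicate (Suc n) 0 ! j)) = 1"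
    by (rule prod.neutral) (simp del: replicate_Suc)
  then show ?thesis
    by (simp add: Suc poly_eval_def del: replicate_Suc prod.lessThan_Suc)
qed (simp add: poly_eval_def)

lemma sum_lessThan_add:
  fixes f :: "nat \<Rightarrow> 'a::comm_monoid_add"
  shows "sum f {..<a + b} = sum f {..<a} + (\<Sum>i<b. f (a + i))"
  by (induction b) (simp_all add: add.assoc)

text \<open>The first block of \<open>exponents\<close> holds the monomials free of the first
  variable, the second those divisible by it. Dividing the latter by that variable takes out the
  factor \<open>of_bool b\<close> and lowers the degree bound to \<open>t\<close>.\<close>

lemma poly_eval_Suc_Suc:
  "poly_eval (Suc m) (Suc t) p (b # y) = poly_eval m (Suc t) p y
     + of_bool b * poly_eval (Suc m) t (\<lambda>i. p (((m + Suc t) choose Suc t) + i)) (b # y)"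
proof -
  let ?mon = "\<lambda>e y. \<Prod>j<length e. (of_bool (y ! j) :: real) ^ (e ! j)"
  let ?E = "exponents m (Suc t)" and ?F = "exponents (Suc m) t"
  have len: "length (exponents k s ! i) = k" if "i < length (exponents k s)" for k s i
    using nth_mem[OF that] by (simp add: set_exponents)
  have mono: "poly_eval k s r z = (\<Sum>i<length (exponents k s). r i * ?mon (exponents k s ! i) z)"
    for k s r z
    unfolding poly_eval_def by (intro sum.cong refl) (simp add: len)
  have zero: "?mon (0 # e) (b # y) = ?mon e y" for e
    by (simp add: prod.lessThan_Suc_shift del: prod.lessThan_Suc)
  have suc: "?mon (Suc (hd e) # tl e) (b # y) = of_bool b * ?mon e (b # y)" if "length e = Suc m" for e
    using that by (cases e) (simp_all add: prod.lessThan_Suc_shift del: prod.lessThan_Suc)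
  have "poly_eval (Suc m) (Suc t) p (b # y)
      = (\<Sum>i<length ?E + length ?F. p i * ?mon (exponents (Suc m) (Suc t) ! i) (b # y))"
    unfolding mono by simp
  also have "\<dots> = (\<Sum>i<length ?E. p i * ?mon (0 # ?E ! i) (b # y))
      + (\<Sum>i<length ?F. p (length ?E + i) * ?mon (Suc (hd (?F ! i)) # tl (?F ! i)) (b # y))"
    unfolding sum_lessThan_add
    by (intro arg_cong2[where f = "(+)"] sum.cong) (simp_all add: nth_append)
  also have "(\<Sum>i<length ?E. p i * ?mon (0 # ?E ! i) (b # y)) = poly_eval m (Suc t) p y"
    unfolding mono zero ..
  also have "(\<Sum>i<length ?F. p (length ?E + i) * ?mon (Suc (hd (?F ! i)) # tl (?F ! i)) (b # y))
      = of_bool b * poly_eval (Suc m) t (\<lambda>i. p (length ?E + i)) (b # y)"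
    unfolding mono sum_distrib_left
    by (intro sum.cong refl) (subst suc, rule len, simp, simp only: mult.left_commute)
  finally show ?thesis by (simp only: length_exponents)
qed


lemma map_upt_add: "map f [0..<a + b] = map f [0..<a] @ map (\<lambda>i. f (a + i)) [0..<b]"
  by (induction b) (simp_all flip: append_assoc)

text \<open>The summand 62 makes the bound inductive: an inner call costs 62 beyond its two
  recursive calls, the binomials of these add up by Pascal's rule, and a leaf costs at most 13 = 75
  - 62. The cost \<open>k\<close> is fixed before tape and position, as \<open>runs_det\<close>
  demands.\<close>

lemma eval_ev_prog:
  assumes "mr = real m" "tr = real t" "length y = m"
  shows "\<exists>k. (\<forall>\<omega> i. eval \<omega> ev_prog
      [VCons (VReal mr) (VCons (VReal tr) (VCons (vbits y)
        (vlist (map (\<lambda>j. VReal (p j)) [0..<(m + t) choose t] @ vs))))]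
      ev_prog i (VCons (VReal (poly_eval m t p y)) (vlist vs)) i k) \<and> k + 62 \<le> 75 * ((m + t) choose t)"
  using assms
proof (induction m t arbitrary: mr tr y p vs rule: exponents.induct)
  case (1 t)
  have "eval \<omega> ev_prog
      [VCons (VReal mr) (VCons (VReal tr) (VCons (vbits y) (vlist (VReal (p 0) # vs))))]
      ev_prog i (VCons (VReal (poly_eval 0 t p y)) (vlist vs)) i 8" for \<omega> i
    by (subst (2) ev_prog_def, rule eval_cong, unfold vlist.simps,
        rule eval_IfLe_le, (rule eval_simple)+, simp add: 1, (rule eval_simple)+)
       (simp_all add: poly_eval_0_left)
  then show ?case by (intro exI[of _ 8]) simp
next
  case (2 m)
  have "eval \<omega> ev_prog
      [VCons (VReal mr) (VCons (VReal tr) (VCons (vbits y) (vlist (VReal (p 0) # vs))))]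
      ev_prog i (VCons (VReal (poly_eval (Suc m) 0 p y)) (vlist vs)) i 13" for \<omega> i
    by (subst (2) ev_prog_def, rule eval_cong, unfold vlist.simps,
        rule eval_IfLe_gt, (rule eval_simple)+, simp add: 2,
        rule eval_IfLe_le, (rule eval_simple)+, simp add: 2, (rule eval_simple)+)
       (simp_all add: poly_eval_0_right)
  then show ?case by (intro exI[of _ 13]) simp
next
  case (3 m t)
  obtain b z where y: "y = b # z" "length z = m"
    using 3 by (cases y) auto
  let ?N1 = "(m + Suc t) choose Suc t" and ?N2 = "(Suc m + t) choose t"
  have N: "(Suc m + Suc t) choose Suc t = ?N1 + ?N2"
    by (simp add: add.commute)
  \<comment> \<open>What the first recursive call leaves over: the coefficients of the second block,
    followed by the surplus \<open>vs\<close>.\<close>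
  let ?vs1 = "map (\<lambda>j. VReal (p (?N1 + j))) [0..<?N2] @ vs"
  have split: "map (\<lambda>j. VReal (p j)) [0..<(Suc m + Suc t) choose Suc t] @ vs
      = map (\<lambda>j. VReal (p j)) [0..<?N1] @ ?vs1"
    by (simp only: N map_upt_add append_assoc)
  have vb: "vbits y = VCons (VReal (of_bool b)) (vbits z)"
    by (simp add: y vbits_def)
  \<comment> \<open>The decremented arity stays in the form that the evaluation rules produce, so
    that the induction hypothesis unifies with the recursive call.\<close>
  obtain k1 where k1: "\<And>\<omega> i. eval \<omega> ev_prog
      [VCons (VReal (apply_aop Sub mr (of_int 1))) (VCons (VReal tr) (VCons (vbits z)
        (vlist (map (\<lambda>j. VReal (p j)) [0..<?N1] @ ?vs1))))]
      ev_prog i (VCons (VReal (poly_eval m (Suc t) p z)) (vlist ?vs1)) i k1" "k1 + 62 \<le> 75 * ?N1"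
    using 3(1)[of "apply_aop Sub mr (of_int 1)" tr z p ?vs1] 3(3,4) y by auto
  obtain k2 where k2: "\<And>\<omega> i. eval \<omega> ev_prog
      [VCons (VReal mr) (VCons (VReal (apply_aop Sub tr (of_int 1))) (VCons (vbits y) (vlist ?vs1)))]
      ev_prog i (VCons (VReal (poly_eval (Suc m) t (\<lambda>j. p (?N1 + j)) y)) (vlist vs)) i k2"
      "k2 + 62 \<le> 75 * ?N2"
    using 3(2)[of mr "apply_aop Sub tr (of_int 1)" y "\<lambda>j. p (?N1 + j)" vs] 3(3-5) by auto
  have "eval \<omega> ev_prog
      [VCons (VReal mr) (VCons (VReal tr) (VCons (vbits y)
        (vlist (map (\<lambda>j. VReal (p j)) [0..<(Suc m + Suc t) choose Suc t] @ vs))))]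
      ev_prog i (VCons (VReal (poly_eval (Suc m) (Suc t) p y)) (vlist vs)) i (k1 + k2 + 62)" for \<omega> i
    unfolding split vb
    by (subst (2) ev_prog_def, rule eval_cong,
        rule eval_IfLe_gt, (rule eval_simple)+, simp add: 3,
        rule eval_IfLe_gt, (rule eval_simple)+, simp add: 3,
        (rule eval_Let eval_Self k1(1) k2(1)[unfolded vb] eval_simple)+)
       (simp_all add: y poly_eval_Suc_Suc)
  then show ?case
    using k1(2) k2(2) unfolding N by (intro exI[of _ "k1 + k2 + 62"]) auto
qed

definition eval_prog :: tm where
  "eval_prog = THead (TCall ev_prog
     (TCons (THead (TTail (TTail (THead (TVar 0)))))
       (TCons (THead (TTail (TTail (TTail (THead (TVar 0))))))
         (TCons (TTail (TTail (TTail (TVar 0)))) (THead (TTail (TTail (TVar 0))))))))"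

lemma runs_eval_prog:
  assumes "length y = m"
  shows "\<exists>k. runs_det eval_prog
      (VCons (vinst \<iota> d m t T) (VCons (VReal \<epsilon>) (VCons (vvec ((m + t) choose t) r) (vbits y))))
      (VReal (poly_eval m t r y)) k \<and> k \<le> 100 * ((m + t) choose t)"
proof -
  let ?N = "(m + t) choose t"
  obtain k where k: "\<And>\<omega> i. eval \<omega> ev_prog
      [VCons (VReal (real m)) (VCons (VReal (real t)) (VCons (vbits y) (vvec ?N r)))]
      ev_prog i (VCons (VReal (poly_eval m t r y)) (vlist [])) i k" "k + 62 \<le> 75 * ?N"
    using eval_ev_prog[OF refl refl assms, of t r "[]"] by (auto simp: vvec_def)
  have "eval \<omega> eval_prog
      [VCons (vinst \<iota> d m t T) (VCons (VReal \<epsilon>) (VCons (vvec ?N r) (vbits y)))] eval_prog 0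
      (VReal (poly_eval m t r y)) 0 (k + 24)" for \<omega>
    by (subst (2) eval_prog_def, unfold vinst_def vlist.simps, rule eval_cong,
        (rule eval_Call k(1)[unfolded vlist.simps] eval_simple)+) simp_all
  then show ?thesis
    using k(2) unfolding runs_det_def by (intro exI[of _ "k + 24"]) auto
qed

section \<open>Accuracy and privacy\<close>

definition mean_vec :: "(bits \<Rightarrow> nat \<Rightarrow> real) \<Rightarrow> bits list \<Rightarrow> nat \<Rightarrow> real" where
  "mean_vec p D j = (\<Sum>x\<leftarrow>D. p x j) / real (length D)"

lemma sum_list_map_nth: "(\<Sum>x\<leftarrow>xs. f x) = (\<Sum>i<length xs. f (xs ! i))"
  by (simp add: sum_list_sum_nth atLeast0LessThan)

text \<open>Only the row in which the databases differ survives in the difference of the sums, and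
  it contributes two coefficients of size at most \<open>T\<close>.\<close>

lemma mean_vec_diff_le:
  assumes "adjacent D D'" and p: "\<And>x. x \<in> set D \<union> set D' \<Longrightarrow> \<bar>p x j\<bar> \<le> T"
  shows "\<bar>mean_vec p D j - mean_vec p D' j\<bar> \<le> 2 * T / real (length D)"
proof -
  have len: "length D' = length D" and "card {i. i < length D \<and> D ! i \<noteq> D' ! i} = 1"
    using assms(1) by (auto simp: adjacent_def)
  then obtain k where k: "{i. i < length D \<and> D ! i \<noteq> D' ! i} = {k}"
    by (auto simp: card_1_singleton_iff)
  then have "k < length D" and off: "\<forall>i. i < length D \<longrightarrow> i \<noteq> k \<longrightarrow> D ! i = D' ! i"
    by (blast, blast)
  have "(\<Sum>x\<leftarrow>D. p x j) - (\<Sum>x\<leftarrow>D'. p x j) = (\<Sum>i<length D. p (D ! i) j - p (D' ! i) j)"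
    by (simp add: sum_list_map_nth len sum_subtractf)
  also have "\<dots> = (\<Sum>i\<in>{k}. p (D ! i) j - p (D' ! i) j)"
    using off \<open>k < length D\<close> by (intro sum.mono_neutral_right) auto
  finally have "\<bar>(\<Sum>x\<leftarrow>D. p x j) - (\<Sum>x\<leftarrow>D'. p x j)\<bar> \<le> \<bar>p (D ! k) j\<bar> + \<bar>p (D' ! k) j\<bar>"
    using abs_triangle_ineq4[of "p (D ! k) j" "p (D' ! k) j"] by simp
  also have "\<dots> \<le> 2 * T"
    using p[of "D ! k"] p[of "D' ! k"] \<open>k < length D\<close> len nth_mem[of k D] nth_mem[of k D'] by auto
  finally have "\<bar>(\<Sum>x\<leftarrow>D. p x j) - (\<Sum>x\<leftarrow>D'. p x j)\<bar> / real (length D) \<le> 2 * T / real (length D)"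
    by (rule divide_right_mono) simp
  then show ?thesis
    by (simp add: mean_vec_def len flip: diff_divide_distrib)
qed

text \<open>At Boolean points every monomial is 0 or 1, so each coefficient contributes at most its
  own error.\<close>

lemma poly_eval_perturb:
  assumes "\<And>i. i < (m + t) choose t \<Longrightarrow> \<bar>r i - r' i\<bar> \<le> e"
  shows "\<bar>poly_eval m t r y - poly_eval m t r' y\<bar> \<le> real ((m + t) choose t) * e"
proof -
  let ?mon = "\<lambda>i. \<Prod>j<m. (of_bool (y ! j) :: real) ^ (exponents m t ! i ! j)"
  have mon: "\<bar>?mon i\<bar> \<le> 1" for i
    by (auto simp: abs_prod power_le_one intro!: prod_le_1)
  have "\<bar>poly_eval m t r y - poly_eval m t r' y\<bar> = \<bar>\<Sum>i<(m + t) choose t. (r i - r' i) * ?mon i\<bar>"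
    by (simp add: poly_eval_def length_exponents sum_subtractf left_diff_distrib)
  also have "\<dots> \<le> (\<Sum>i<(m + t) choose t. \<bar>(r i - r' i) * ?mon i\<bar>)"
    by (rule sum_abs)
  also have "\<dots> \<le> (\<Sum>i<(m + t) choose t. e)"
  proof (rule sum_mono)
    fix i assume "i \<in> {..<(m + t) choose t}"
    then have "\<bar>r i - r' i\<bar> * \<bar>?mon i\<bar> \<le> e * 1"
      using assms[of i] mon[of i] by (intro mult_mono) auto
    then show "\<bar>(r i - r' i) * ?mon i\<bar> \<le> e"
      by (simp add: abs_mult)
  qed
  finally show ?thesis by simp
qed

lemma poly_eval_mean_vec:
  "poly_eval m t (mean_vec p D) y = (\<Sum>x\<leftarrow>D. poly_eval m t (p x) y) / real (length D)"
  unfolding poly_eval_def mean_vec_def sum_list_map_nth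
  by (subst sum.swap) (simp add: sum_divide_distrib sum_distrib_right)

text \<open>Evaluation is linear in the coefficients and \<open>query_value\<close> is the mean of
  \<open>query_fun\<close> over the rows, so the error is a mean of errors of size at most
  \<open>\<gamma>\<close>.\<close>

lemma poly_eval_mean_vec_approx:
  assumes "D \<noteq> []" and "\<And>x. x \<in> set D \<Longrightarrow> \<bar>query_fun q x y - poly_eval m t (p x) y\<bar> \<le> \<gamma>"
  shows "\<bar>poly_eval m t (mean_vec p D) y - query_value (q y) D\<bar> \<le> \<gamma>"
proof -
  have "\<bar>(\<Sum>i<length D. poly_eval m t (p (D ! i)) y - query_fun q (D ! i) y)\<bar>
      \<le> (\<Sum>i<length D. \<bar>poly_eval m t (p (D ! i)) y - query_fun q (D ! i) y\<bar>)"
    by (rule sum_abs)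
  also have "\<dots> \<le> (\<Sum>i<length D. \<gamma>)"
    using assms(2) by (intro sum_mono) (simp add: abs_minus_commute)
  also have "\<dots> = real (length D) * \<gamma>"
    by simp
  finally have "\<bar>(\<Sum>i<length D. poly_eval m t (p (D ! i)) y - query_fun q (D ! i) y)\<bar> / real (length D) \<le> \<gamma>"
    using assms(1) by (simp add: divide_le_eq mult.commute)
  then show ?thesis
    by (simp add: poly_eval_mean_vec query_value_def query_fun_def sum_list_map_nth sum_subtractf
        flip: diff_divide_distrib)
qed

lemma poly_eval_measurable:
  "(\<lambda>r. poly_eval m t r y) \<in> borel_measurable (RN ((m + t) choose t))"
  unfolding poly_eval_def RN_def length_exponents by measurable

text \<open>The cube is finite, so this is a finite intersection of measurable sets.\<close>

lemma accuracy_set_measurable: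
  assumes "Y \<subseteq> cube m"
  shows "{r \<in> space (RN ((m + t) choose t)). \<forall>y\<in>Y. \<bar>poly_eval m t r y - v y\<bar> \<le> \<alpha>}
    \<in> sets (RN ((m + t) choose t))"
proof -
  have "finite Y"
    using finite_lists_length_eq[of "UNIV :: bool set" m] assms
    by (auto simp: cube_def intro: finite_subset)
  moreover note poly_eval_measurable[measurable]
  ultimately show ?thesis
    by (intro sets.sets_Collect_finite_All) measurable
qed

section \<open>The sanitizer for a family of query sets\<close>

theorem theorem4:
  fixes Appr :: tm and C K :: nat
  shows "\<exists>San Ev :: tm. \<exists>C' K' :: nat.
    \<forall>(\<iota> :: nat list) (d :: nat) (m :: nat) (t :: nat) (T :: real) (\<gamma> :: real)
      (Y :: bits set) (q :: bits \<Rightarrow> bits \<Rightarrow> bool).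
      Y \<subseteq> cube m \<longrightarrow>
      efficiently_uniformly_approximates Appr C K \<iota> d m t T \<gamma> Y q \<longrightarrow>
      (\<forall>(n :: nat) (\<epsilon> :: real). 0 < n \<longrightarrow> 0 < \<epsilon> \<longrightarrow>
        (let N = (m + t) choose t;
             B = poly_bound C' K' [real n, real d, real N, lnp T, lnp (1 / \<epsilon>)]
         in \<exists>A E.
              sanitizer_in_time San (vinst \<iota> d m t T) \<epsilon> N d n A B \<and>
              evaluator_in_time Ev (vinst \<iota> d m t T) \<epsilon> N Y E B \<and>
              differentially_private \<epsilon> N d n A \<and>
              (\<forall>\<beta>>0. accurate (\<gamma> + 4 * T * (real N)\<^sup>2 * ln (real N / \<beta>) / (\<epsilon> * real n))
                        \<beta> N d n Y q A E)))"
proof (rule exI[of _ "san_prog Appr"], rule exI[of _ eval_prog], rule exI[of _ "C + 208"],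
    rule exI[of _ "K + 2"], intro allI impI)
  fix \<iota> :: "nat list" and d m t :: nat and T \<gamma> :: real and Y :: "bits set"
    and q :: "bits \<Rightarrow> bits \<Rightarrow> bool" and n :: nat and \<epsilon> :: real
  assume Y: "Y \<subseteq> cube m" and eff: "efficiently_uniformly_approximates Appr C K \<iota> d m t T \<gamma> Y q"
    and n: "0 < n" and \<epsilon>: "0 < \<epsilon>"
  define N where "N = (m + t) choose t"
  have "N > 0" by (simp add: N_def)
  \<comment> \<open>\<open>w\<close> is the base of the time bound of the approximation algorithm
    and \<open>z\<close> that of the sanitizer; \<open>w \<le> z\<close>.\<close>
  define w where "w = 1 + real d + real N + lnp T"
  define z where "z = 1 + real n + real d + real N + lnp T + lnp (1 / \<epsilon>)"
  \<comment> \<open>208 = 19 + 38 + 51 + 100 collects the constants of \<open>runs_san_prog\<close>,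
    and the exponent leaves room for the factor \<open>n\<close> of the row costs and for the
    product \<open>N n\<close>.\<close>
  define B where "B = poly_bound (C + 208) (K + 2) [real n, real d, real N, lnp T, lnp (1 / \<epsilon>)]"
  have B: "B = real (C + 208) * z ^ (K + 2)"
    by (simp add: B_def poly_bound_def z_def algebra_simps)
  have lnp: "0 \<le> lnp x" for x
    by (simp add: lnp_def)
  have z: "1 \<le> z" "real n \<le> z" "real N \<le> z" "w \<le> z" "0 \<le> w"
    using lnp[of T] lnp[of "1 / \<epsilon>"] by (auto simp: z_def w_def)
  have z2: "z ^ 2 \<le> z ^ (K + 2)" "z \<le> z ^ 2" "1 \<le> z ^ 2"
    using z power_increasing[of 2 "K + 2" z] power_increasing[of 1 2 z] one_le_power[of z 2] by auto
  \<comment> \<open>In this form both polynomial and cost can be chosen as functions of the row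
    alone. Adjacent databases then use the same \<open>p x\<close> for a common row.\<close>
  from eff have "\<forall>x. \<exists>p k. x \<in> cube d \<longrightarrow> p \<in> polys m t T \<and> approximates m t \<gamma> Y (query_fun q x) p \<and>
      runs_det Appr (VCons (vinst \<iota> d m t T) (vbits x)) (vvec N p) k \<and> real k \<le> real C * w ^ K"
    unfolding efficiently_uniformly_approximates_def
    by (simp add: N_def w_def poly_bound_def add.assoc) blast
  then obtain p k where *: "\<forall>x. x \<in> cube d \<longrightarrow> p x \<in> polys m t T \<and>
      approximates m t \<gamma> Y (query_fun q x) (p x) \<and>
      runs_det Appr (VCons (vinst \<iota> d m t T) (vbits x)) (vvec N (p x)) (k x) \<and> real (k x) \<le> real C * w ^ K"
    by metis
  have p_le: "\<bar>p x j\<bar> \<le> T" if "x \<in> cube d" "j < N" for x j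
  proof -
    have "p x \<in> {..<N} \<rightarrow>\<^sub>E {-T..T}"
      using * that by (auto simp: polys_def N_def)
    from PiE_mem[OF this, of j] that(2) show ?thesis by auto
  qed
  \<comment> \<open>The cube contains a point and \<open>N > 0\<close>, so some coefficient has
    absolute value at most \<open>T\<close>.\<close>
  have "0 \<le> T"
    using p_le[of "replicate d False" 0] \<open>N > 0\<close> by (simp add: cube_def)
  define b where "b = 2 * T * real N / (\<epsilon> * real n)"
  have "0 \<le> b" using \<open>0 \<le> T\<close> \<epsilon> by (simp add: b_def)
  define A where "A D = distr tape (RN N) (noisy N b (mean_vec p D))" for D

  have "sanitizer_in_time (san_prog Appr) (vinst \<iota> d m t T) \<epsilon> N d n A B"
    unfolding sanitizer_in_time_def
  proof
    fix D assume D: "D \<in> databases d n"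
    then have "length D = n" "D \<noteq> []" "set D \<subseteq> cube d"
      using n by (auto simp: databases_def)
    have "real (\<Sum>x\<leftarrow>D. k x) \<le> (\<Sum>i<n. real C * w ^ K)"
      unfolding sum_list_map_nth of_nat_sum \<open>length D = n\<close>
    proof (rule sum_mono)
      fix i assume "i \<in> {..<n}"
      then have "D ! i \<in> cube d"
        using \<open>set D \<subseteq> cube d\<close> \<open>length D = n\<close> nth_mem[of i D] by auto
      then show "real (k (D ! i)) \<le> real C * w ^ K"
        using * by blast
    qed
    also have "\<dots> = real n * (real C * w ^ K)"
      by simp
    also have "\<dots> \<le> z * (real C * z ^ K)"
      using z by (intro mult_mono power_mono) auto
    also have "\<dots> = real C * z ^ Suc K"
      by simp
    also have "\<dots> \<le> real C * z ^ (K + 2)"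
      using z by (intro mult_left_mono power_increasing) auto
    finally have sum_k: "real (\<Sum>x\<leftarrow>D. k x) \<le> real C * z ^ (K + 2)" .
    have Nn: "real N * real n \<le> z ^ 2"
      using z unfolding power2_eq_square by (intro mult_mono) auto
    have "\<exists>c. runs \<omega> (san_prog Appr) (VCons (vinst \<iota> d m t T) (VCons (VReal \<epsilon>) (vdb D)))
        (vvec N (noisy N b (mean_vec p D) \<omega>)) c \<and> real c \<le> B" for \<omega>
    proof -
      have "\<exists>c. runs \<omega> (san_prog Appr) (VCons (vinst \<iota> d m t T) (VCons (VReal \<epsilon>) (vdb D)))
          (vvec N (noisy N b (mean_vec p D) \<omega>)) c
        \<and> c \<le> (\<Sum>x\<leftarrow>D. k x) + (19 * N + 38) * n + 51 * N + 100"
        unfolding b_def mean_vec_def[abs_def] \<open>length D = n\<close>[symmetric]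
        using * \<open>set D \<subseteq> cube d\<close> by (intro runs_san_prog \<open>D \<noteq> []\<close>) auto
      then obtain c where c: "runs \<omega> (san_prog Appr) (VCons (vinst \<iota> d m t T) (VCons (VReal \<epsilon>) (vdb D)))
          (vvec N (noisy N b (mean_vec p D) \<omega>)) c"
          "c \<le> (\<Sum>x\<leftarrow>D. k x) + (19 * N + 38) * n + 51 * N + 100"
        by blast
      have "real c \<le> real (\<Sum>x\<leftarrow>D. k x) + 19 * (real N * real n) + 38 * real n + 51 * real N + 100"
        using of_nat_mono[OF c(2), where 'a = real] by (simp add: algebra_simps)
      also have "\<dots> \<le> real C * z ^ (K + 2) + 208 * z ^ (K + 2)"
        using sum_k Nn z(2,3) z2 by linarith
      also have "\<dots> = B"
        unfolding B by (simp add: distrib_right)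
      finally show ?thesis using c(1) by blast
    qed
    then show "\<exists>out\<in>tape \<rightarrow>\<^sub>M RN N. A D = distr tape (RN N) out \<and>
      (\<forall>\<omega>\<in>space tape. \<exists>c. runs \<omega> (san_prog Appr) (VCons (vinst \<iota> d m t T) (VCons (VReal \<epsilon>) (vdb D)))
        (vvec N (out \<omega>)) c \<and> real c \<le> B)"
      by (intro bexI[of _ "noisy N b (mean_vec p D)"]) (simp_all add: A_def)
  qed

  moreover have "evaluator_in_time eval_prog (vinst \<iota> d m t T) \<epsilon> N Y (poly_eval m t) B"
    unfolding evaluator_in_time_def
  proof (intro ballI)
    fix r y assume "y \<in> Y"
    then have "length y = m" using Y by (auto simp: cube_def)
    from runs_eval_prog[OF this, of \<iota> d t T \<epsilon> r] obtain c where
      c: "runs_det eval_prog (VCons (vinst \<iota> d m t T) (VCons (VReal \<epsilon>) (VCons (vvec N r) (vbits y))))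
        (VReal (poly_eval m t r y)) c" "c \<le> 100 * N"
      unfolding N_def by blast
    have "real c \<le> 208 * z ^ (K + 2)"
      using of_nat_mono[OF c(2), where 'a = real] z(3) z2 by linarith
    also have "\<dots> \<le> B"
      unfolding B using z by (simp add: mult_right_mono)
    finally show "\<exists>c. runs_det eval_prog
        (VCons (vinst \<iota> d m t T) (VCons (VReal \<epsilon>) (VCons (vvec N r) (vbits y))))
        (VReal (poly_eval m t r y)) c \<and> real c \<le> B"
      using c(1) by blast
  qed

  moreover have "differentially_private \<epsilon> N d n A"
    unfolding differentially_private_def A_def
  proof (intro ballI impI measure_noisy_le)
    fix D D' assume D: "D \<in> databases d n" "D' \<in> databases d n" and adj: "adjacent D D'"
    have cube: "set D \<union> set D' \<subseteq> cube d" "length D = n"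
      using D by (auto simp: databases_def)
    have sens: "\<bar>mean_vec p D j - mean_vec p D' j\<bar> \<le> 2 * T / real n" if "j < N" for j
      using mean_vec_diff_le[OF adj, of p j T] p_le that cube by blast
    \<comment> \<open>Scale 0 means \<open>T = 0\<close>, and then the sensitivity is 0 as
      well.\<close>
    show "mean_vec p D j = mean_vec p D' j" if "j < N" "b = 0" for j
      using sens[OF that(1)] that \<open>N > 0\<close> n \<epsilon> by (simp add: b_def)
    have "(\<Sum>j<N. \<bar>mean_vec p D j - mean_vec p D' j\<bar>) \<le> (\<Sum>j<N. 2 * T / real n)"
      by (intro sum_mono sens) simp
    \<comment> \<open>This identity dictates the scale: the L1 sensitivity \<open>2 T N / n\<close>
      divided by \<open>\<epsilon>\<close>.\<close>
    also have "\<dots> = \<epsilon> * b"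
      using \<epsilon> by (simp add: b_def)
    finally show "(\<Sum>j<N. \<bar>mean_vec p D j - mean_vec p D' j\<bar>) / b \<le> \<epsilon>"
      using \<open>0 \<le> b\<close> \<epsilon> by (cases "b = 0") (auto simp: divide_le_eq)
  qed (use \<open>0 \<le> b\<close> in auto)

  moreover have "accurate (\<gamma> + 4 * T * (real N)\<^sup>2 * ln (real N / \<beta>) / (\<epsilon> * real n)) \<beta> N d n Y q A (poly_eval m t)"
    if "0 < \<beta>" for \<beta>
    unfolding accurate_def
  proof (intro ballI conjI)
    fix D assume D: "D \<in> databases d n"
    then have "length D = n" "D \<noteq> []" "set D \<subseteq> cube d"
      using n by (auto simp: databases_def)
    define s where "s = ln (real N / \<beta>)"
    let ?S = "{r \<in> space (RN N). \<forall>y\<in>Y. \<bar>poly_eval m t r y - query_value (q y) D\<bar>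
      \<le> \<gamma> + 4 * T * (real N)\<^sup>2 * s / (\<epsilon> * real n)}"
    have S: "?S \<in> sets (RN N)"
      unfolding N_def by (rule accuracy_set_measurable[OF Y])
    then show "{r \<in> space (RN N). \<forall>y\<in>Y. \<bar>poly_eval m t r y - query_value (q y) D\<bar>
      \<le> \<gamma> + 4 * T * (real N)\<^sup>2 * ln (real N / \<beta>) / (\<epsilon> * real n)} \<in> sets (RN N)"
      by (simp only: s_def)
    have "1 - \<beta> \<le> measure (A D) ?S"
    \<comment> \<open>For \<open>\<beta> \<le> 1\<close> the threshold \<open>s\<close> is
      nonnegative, as the tail bound requires; for larger \<open>\<beta>\<close> the claimed
      probability is negative.\<close>
    proof (cases "\<beta> \<le> 1")
      case True
      then have "1 \<le> real N / \<beta>"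
        using \<open>N > 0\<close> \<open>0 < \<beta>\<close> by (simp add: le_divide_eq)
      then have "0 \<le> s" by (simp add: s_def)
      have "exp s = real N / \<beta>"
        using \<open>N > 0\<close> \<open>0 < \<beta>\<close> by (simp add: s_def)
      then have "1 - \<beta> = 1 - real N * exp (- s)"
        using \<open>N > 0\<close> by (simp add: exp_minus)
      also have "\<dots> \<le> measure (A D) ?S"
        unfolding A_def
      proof (rule noisy_concentration[OF \<open>0 \<le> s\<close> S])
        fix \<omega> assume \<omega>: "\<omega> \<in> space tape" "\<forall>i<N. \<bar>lap (\<omega> i)\<bar> \<le> s"
        let ?r = "noisy N b (mean_vec p D) \<omega>"
        have "\<bar>poly_eval m t ?r y - query_value (q y) D\<bar> \<le> \<gamma> + 4 * T * (real N)\<^sup>2 * s / (\<epsilon> * real n)"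
          if "y \<in> Y" for y
        proof -
          have "\<bar>?r i - mean_vec p D i\<bar> \<le> b * s" if "i < N" for i
            using \<omega>(2) that \<open>0 \<le> b\<close> by (simp add: noisy_def abs_mult mult_left_mono)
          then have "\<bar>poly_eval m t ?r y - poly_eval m t (mean_vec p D) y\<bar> \<le> real N * (b * s)"
            unfolding N_def by (rule poly_eval_perturb)
          also have "\<dots> = 2 * T * (real N)\<^sup>2 * s / (\<epsilon> * real n)"
            by (simp add: b_def power2_eq_square)
          \<comment> \<open>The union bound yields the factor 2; it is relaxed to 4 using
            \<open>0 \<le> T\<close> and \<open>0 \<le> s\<close>.\<close>
          also have "\<dots> \<le> 4 * T * (real N)\<^sup>2 * s / (\<epsilon> * real n)"
            using \<open>0 \<le> T\<close> \<open>0 \<le> s\<close> \<epsilon> by (intro divide_right_mono mult_right_mono) auto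
          finally have "\<bar>poly_eval m t ?r y - poly_eval m t (mean_vec p D) y\<bar>
            \<le> 4 * T * (real N)\<^sup>2 * s / (\<epsilon> * real n)" .
          moreover have "\<bar>poly_eval m t (mean_vec p D) y - query_value (q y) D\<bar> \<le> \<gamma>"
            using * \<open>set D \<subseteq> cube d\<close> \<open>y \<in> Y\<close> \<open>D \<noteq> []\<close>
            by (intro poly_eval_mean_vec_approx) (auto simp: approximates_def)
          ultimately show ?thesis by linarith
        qed
        then show "?r \<in> ?S"
          using measurable_space[OF noisy_measurable \<omega>(1)] by blast
      qed
      finally show ?thesis .
    qed (simp add: order.trans[OF _ measure_nonneg])
    then show "1 - \<beta> \<le> measure (A D) {r \<in> space (RN N). \<forall>y\<in>Y. \<bar>poly_eval m t r y - query_value (q y) D\<bar>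
      \<le> \<gamma> + 4 * T * (real N)\<^sup>2 * ln (real N / \<beta>) / (\<epsilon> * real n)}"
      by (simp only: s_def)
  qed

  ultimately show "let N = (m + t) choose t;
       B = poly_bound (C + 208) (K + 2) [real n, real d, real N, lnp T, lnp (1 / \<epsilon>)]
     in \<exists>A E.
          sanitizer_in_time (san_prog Appr) (vinst \<iota> d m t T) \<epsilon> N d n A B \<and>
          evaluator_in_time eval_prog (vinst \<iota> d m t T) \<epsilon> N Y E B \<and>
          differentially_private \<epsilon> N d n A \<and>
          (\<forall>\<beta>>0. accurate (\<gamma> + 4 * T * (real N)\<^sup>2 * ln (real N / \<beta>) / (\<epsilon> * real n))
                    \<beta> N d n Y q A E)"
    unfolding Let_def N_def[symmetric] B_def[symmetric] by blast
qed

end
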